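(* Let $\mathbb{A}$ be a PCA with elementary sub-PCA $\mathbb{A}'$. The Weihrauch doctrine $\mathfrak{W}$ is isomorphic to the pure existential completion of the elementary Weihrauch doctrine $\mathfrak{eW}$: $$\mathfrak{W}\equiv\mathfrak{eW}^{\exists}.$$ In particular, for every $X\subseteq\mathbb{A}$ the map $(\pi_X,f)\mapsto F$, where $\pi_X\colon X\times Y\to X$ is a product projection, $f\in\mathfrak{eW}(X\times Y)$, and $F\colon X\to\wp^*(\mathbb{A})^Y$ is defined as $F(x):=f(x,\cdot)$, is an isomorphism of posets between $(\mathfrak{eW}^{\exists}(X),\le_\exists)$ and $(\mathfrak{W}(X),\le_{\mathsf W})$.
   Context: A partial combinatory algebra (PCA) is a set $\mathbb{A}$ with a partial binary operation $\cdot$ (application, associating to the left; $ab\downarrow$ means that $ab$ is defined; $x\simeq y$ means that $x$ is defined whenever $y$ is, in which case they are equal) for which there exist $k,s\in\mathbb{A}$ such that for all $a,b,c\in\mathbb{A}$: $ka\downarrow$, $kab\simeq a$, $sa\downarrow$, $sab\downarrow$, $sabc\simeq ac(bc)$. An elementary sub-PCA is a subset $\mathbb{A}'\subseteq\mathbb{A}$ closed under (defined) application that contains elements $k,s$ such that $ka\downarrow$, $kab\simeq a$, $sa\downarrow$, $sab\downarrow$ and $sabc\simeq ac(bc)$ for all $a,b,c\in\mathbb{A}$. Fix pairing and projection elements $\mathsf{pair},\mathsf{fst},\mathsf{snd}\in\mathbb{A}'$ with $\mathsf{fst}\cdot(\mathsf{pair}\,a\,b)=a$, $\mathsf{snd}\cdot(\mathsf{pair}\,a\,b)=b$,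 and write $\langle a,b\rangle:=\mathsf{pair}\,a\,b$. $\wp^*(\mathbb{A})$ is the set of nonempty subsets of $\mathbb{A}$. Assertions such as $a\cdot b\in S$ include that $a\cdot b$ is defined. $\mathsf{Mod}_{\mathsf p}(\mathbb{A},\mathbb{A}')$ is the category with objects the subsets $X\subseteq\mathbb{A}$ and morphisms $X\to Y$ the computable functions, i.e. the functions $f\colon X\to Y$ for which there is $a\in\mathbb{A}'$ with $a\cdot x\downarrow$ and $f(x)=a\cdot x$ for all $x\in X$. Its products are $X\times Y=\{\langle x,y\rangle:x\in X,y\in Y\}$. With abuse of notation, $\overline k\cdot p$ denotes the value at $p$ of a computable function $\overline k$. A doctrine is a functor $P\colon\mathcal{C}^{\mathrm{op}}\to\mathsf{Pos}$ with $\mathcal{C}$ having finite products; an isomorphism of doctrines on the same base is a natural family of poset isomorphisms. Pure existential completion: $P^{\exists}(A)$ is the poset reflection of the preorder of pairs $(\pi,\alpha)$ with $\pi\colon A\times B\to A$ a product projection and $\alpha\in P(A\times B)$, where $(\pi\colon A\times B\to A,\alpha)\le_\exists(\pi'\colon A\times C\to A,\beta)$ iff there is $h\colon A\times B\to A\times C$ with $\pi'h=\pi$ and $\alpha\le P_h(\beta)$. It acts on a morphism $u\colon A'\to A$ by pulling back: $(\pi\colon A\times B\to A,\alpha)\mapsto(A'\times B\to A',P_{u\times\mathrm{id}_B}(\alpha))$. Elementary Weihrauch doctrine $\mathfrak{eW}\colon\mathsf{Mod}_{\mathsf p}(\mathbb{A},\mathbb{A}')^{\mathrm{op}}\to\mathsf{Pos}$: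 $\mathfrak{eW}(X)$ is the poset reflection of the set of functions $X\to\wp^*(\mathbb{A})$ preordered by $f\le_{\mathsf{dW}}g$ iff there is $\overline h\in\mathbb{A}'$ with $(\forall p\in X)(\forall q\in g(p))(\overline h\cdot\langle p,q\rangle\in f(p))$; it acts by precomposition. Weihrauch doctrine $\mathfrak{W}\colon\mathsf{Mod}_{\mathsf p}(\mathbb{A},\mathbb{A}')^{\mathrm{op}}\to\mathsf{Pos}$: $\mathfrak{W}(X)$ is the poset reflection of the preorder whose objects are generalized Weihrauch predicates on $X$, i.e. functions $F\colon X\to\wp^*(\mathbb{A})^Y$ for some $Y\subseteq\mathbb{A}$ (write $F(x,y)=F(x)(y)$), with $F\le_{\mathsf W}G$, for $F\colon X\to\wp^*(\mathbb{A})^Y$ and $G\colon X\to\wp^*(\mathbb{A})^Z$, iff there are a computable function $\overline k\colon X\times Y\to Z$ and $\overline h\in\mathbb{A}'$ such that $(\forall\langle x,y\rangle\in X\times Y)(\forall q\in G(x,\overline k\cdot\langle x,y\rangle))(\overline h\cdot\langle\langle x,y\rangle,q\rangle\in F(x,y))$. It acts by precomposition. Equivalence classes are identified with representatives. *)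

theory Defs
  imports "HOL-Algebra.Order" "HOL-Library.FuncSet"
begin

section \<open>Posets and poset reflections\<close>

definition poset_isomorphism :: "'p gorder \<Rightarrow> 'q gorder \<Rightarrow> ('p \<Rightarrow> 'q) \<Rightarrow> bool" where
  "poset_isomorphism L M \<phi> \<longleftrightarrow>
     partial_order L \<and> partial_order M \<and>
     bij_betw \<phi> (carrier L) (carrier M) \<and>
     (\<forall>x\<in>carrier L. \<forall>y\<in>carrier L. x \<sqsubseteq>\<^bsub>L\<^esub> y \<longleftrightarrow> \<phi> x \<sqsubseteq>\<^bsub>M\<^esub> \<phi> y)"

definition mutual :: "'b set \<Rightarrow> ('b \<Rightarrow> 'b \<Rightarrow> bool) \<Rightarrow> ('b \<times> 'b) set" where
  "mutual S R = {(x, y). x \<in> S \<and> y \<in> S \<and> R x y \<and> R y x}"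

definition refl_class :: "'b set \<Rightarrow> ('b \<Rightarrow> 'b \<Rightarrow> bool) \<Rightarrow> 'b \<Rightarrow> 'b set" where
  "refl_class S R x = mutual S R `` {x}"

definition poset_reflection :: "'b set \<Rightarrow> ('b \<Rightarrow> 'b \<Rightarrow> bool) \<Rightarrow> 'b set gorder" where
  "poset_reflection S R =
     \<lparr>carrier = S // mutual S R, eq = (=), le = (\<lambda>c d. \<exists>x\<in>c. \<exists>y\<in>d. R x y)\<rparr>"

text \<open>The map into the reflection of \<open>(S, R)\<close> induced on classes by a monotone map of preorders:
  the union below is over equal classes, as in the lifting idiom of \<open>Equiv_Relations\<close>.\<close>

definition reflect_map :: "'b set \<Rightarrow> ('b \<Rightarrow> 'b \<Rightarrow> bool) \<Rightarrow> ('c \<Rightarrow> 'b) \<Rightarrow> 'c set \<Rightarrow> 'b set" where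
  "reflect_map S R \<phi> c = (\<Union>x\<in>c. refl_class S R (\<phi> x))"


section \<open>Categories with finite products and doctrines\<close>

text \<open>\<open>Comp C g f\<close> is the composite of \<open>g\<close> after \<open>f\<close>. Binary products are chosen.\<close>

record ('o, 'm) prod_cat =
  Ob :: "'o set"
  Arr :: "'m set"
  Dom :: "'m \<Rightarrow> 'o"
  Cod :: "'m \<Rightarrow> 'o"
  Ident :: "'o \<Rightarrow> 'm"
  Comp :: "'m \<Rightarrow> 'm \<Rightarrow> 'm"
  Prod :: "'o \<Rightarrow> 'o \<Rightarrow> 'o"
  Proj1 :: "'o \<Rightarrow> 'o \<Rightarrow> 'm"
  Proj2 :: "'o \<Rightarrow> 'o \<Rightarrow> 'm"

definition Hom :: "('o, 'm) prod_cat \<Rightarrow> 'o \<Rightarrow> 'o \<Rightarrow> 'm set" where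
  "Hom C A B = {f \<in> Arr C. Dom C f = A \<and> Cod C f = B}"

locale category_with_products =
  fixes C :: "('o, 'm) prod_cat"
  assumes Dom_closed: "f \<in> Arr C \<Longrightarrow> Dom C f \<in> Ob C"
    and Cod_closed: "f \<in> Arr C \<Longrightarrow> Cod C f \<in> Ob C"
    and Ident_Hom: "A \<in> Ob C \<Longrightarrow> Ident C A \<in> Hom C A A"
    and Comp_Hom: "f \<in> Hom C A B \<Longrightarrow> g \<in> Hom C B D \<Longrightarrow> Comp C g f \<in> Hom C A D"
    and Comp_Ident: "f \<in> Hom C A B \<Longrightarrow> Comp C f (Ident C A) = f"
    and Ident_Comp: "f \<in> Hom C A B \<Longrightarrow> Comp C (Ident C B) f = f"
    and Comp_assoc: "f \<in> Hom C A B \<Longrightarrow> g \<in> Hom C B D \<Longrightarrow> h \<in> Hom C D E \<Longrightarrow>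
           Comp C h (Comp C g f) = Comp C (Comp C h g) f"
    and terminal: "\<exists>T\<in>Ob C. \<forall>A\<in>Ob C. \<exists>!f. f \<in> Hom C A T"
    and Prod_closed: "A \<in> Ob C \<Longrightarrow> B \<in> Ob C \<Longrightarrow> Prod C A B \<in> Ob C"
    and Proj1_Hom: "A \<in> Ob C \<Longrightarrow> B \<in> Ob C \<Longrightarrow> Proj1 C A B \<in> Hom C (Prod C A B) A"
    and Proj2_Hom: "A \<in> Ob C \<Longrightarrow> B \<in> Ob C \<Longrightarrow> Proj2 C A B \<in> Hom C (Prod C A B) B"
    and Prod_universal: "A \<in> Ob C \<Longrightarrow> B \<in> Ob C \<Longrightarrow> f \<in> Hom C Z A \<Longrightarrow> g \<in> Hom C Z B \<Longrightarrow>
           \<exists>!h. h \<in> Hom C Z (Prod C A B) \<and> Comp C (Proj1 C A B) h = f \<and> Comp C (Proj2 C A B) h = g"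

text \<open>The arrow \<open>u \<times> id\<^sub>B\<close>.\<close>

definition prod_ident :: "('o, 'm) prod_cat \<Rightarrow> 'm \<Rightarrow> 'o \<Rightarrow> 'm" where
  "prod_ident C u B =
     (THE h. h \<in> Hom C (Prod C (Dom C u) B) (Prod C (Cod C u) B) \<and>
        Comp C (Proj1 C (Cod C u) B) h = Comp C u (Proj1 C (Dom C u) B) \<and>
        Comp C (Proj2 C (Cod C u) B) h = Proj2 C (Dom C u) B)"

record ('o, 'm, 'p) doctrine_data =
  Fib :: "'o \<Rightarrow> 'p gorder"
  Reindex :: "'m \<Rightarrow> 'p \<Rightarrow> 'p"

locale doctrine = category_with_products C
  for C :: "('o, 'm) prod_cat" and P :: "('o, 'm, 'p) doctrine_data" +
  assumes Fib_poset: "A \<in> Ob C \<Longrightarrow> partial_order (Fib P A)"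
    and Reindex_closed: "u \<in> Hom C A B \<Longrightarrow> \<alpha> \<in> carrier (Fib P B) \<Longrightarrow>
           Reindex P u \<alpha> \<in> carrier (Fib P A)"
    and Reindex_mono: "u \<in> Hom C A B \<Longrightarrow> \<alpha> \<in> carrier (Fib P B) \<Longrightarrow> \<beta> \<in> carrier (Fib P B) \<Longrightarrow>
           \<alpha> \<sqsubseteq>\<^bsub>Fib P B\<^esub> \<beta> \<Longrightarrow> Reindex P u \<alpha> \<sqsubseteq>\<^bsub>Fib P A\<^esub> Reindex P u \<beta>"
    and Reindex_Ident: "A \<in> Ob C \<Longrightarrow> \<alpha> \<in> carrier (Fib P A) \<Longrightarrow> Reindex P (Ident C A) \<alpha> = \<alpha>"
    and Reindex_Comp: "u \<in> Hom C A B \<Longrightarrow> v \<in> Hom C B D \<Longrightarrow> \<alpha> \<in> carrier (Fib P D) \<Longrightarrow>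
           Reindex P (Comp C v u) \<alpha> = Reindex P u (Reindex P v \<alpha>)"

definition doctrine_isomorphism ::
  "('o, 'm) prod_cat \<Rightarrow> ('o, 'm, 'p) doctrine_data \<Rightarrow> ('o, 'm, 'q) doctrine_data
    \<Rightarrow> ('o \<Rightarrow> 'p \<Rightarrow> 'q) \<Rightarrow> bool" where
  "doctrine_isomorphism C P Q \<phi> \<longleftrightarrow>
     doctrine C P \<and> doctrine C Q \<and>
     (\<forall>A\<in>Ob C. poset_isomorphism (Fib P A) (Fib Q A) (\<phi> A)) \<and>
     (\<forall>A\<in>Ob C. \<forall>B\<in>Ob C. \<forall>u\<in>Hom C A B. \<forall>\<alpha>\<in>carrier (Fib P B).
        \<phi> A (Reindex P u \<alpha>) = Reindex Q u (\<phi> B \<alpha>))"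

definition isomorphic_doctrines ::
  "('o, 'm) prod_cat \<Rightarrow> ('o, 'm, 'p) doctrine_data \<Rightarrow> ('o, 'm, 'q) doctrine_data \<Rightarrow> bool" where
  "isomorphic_doctrines C P Q \<longleftrightarrow> (\<exists>\<phi>. doctrine_isomorphism C P Q \<phi>)"


section \<open>Pure existential completion\<close>

text \<open>The pair of the projection \<open>A \<times> B \<rightarrow> A\<close> and \<open>\<alpha> \<in> P(A \<times> B)\<close> is represented by \<open>(B, \<alpha>)\<close>.
  Recording \<open>B\<close> is needed for the reindexing along \<open>u \<times> id\<^sub>B\<close>, and the projection as an arrow need not
  determine it: for subsets of a PCA, \<open>{} \<times> B = {}\<close> for all \<open>B\<close>.\<close>

definition ex_objects ::
  "('o, 'm) prod_cat \<Rightarrow> ('o, 'm, 'p) doctrine_data \<Rightarrow> 'o \<Rightarrow> ('o \<times> 'p) set" where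
  "ex_objects C P A = {(B, \<alpha>). B \<in> Ob C \<and> \<alpha> \<in> carrier (Fib P (Prod C A B))}"

definition ex_le ::
  "('o, 'm) prod_cat \<Rightarrow> ('o, 'm, 'p) doctrine_data \<Rightarrow> 'o \<Rightarrow> 'o \<times> 'p \<Rightarrow> 'o \<times> 'p \<Rightarrow> bool" where
  "ex_le C P A = (\<lambda>(B, \<alpha>) (D, \<beta>).
     \<exists>h\<in>Hom C (Prod C A B) (Prod C A D).
       Comp C (Proj1 C A D) h = Proj1 C A B \<and> \<alpha> \<sqsubseteq>\<^bsub>Fib P (Prod C A B)\<^esub> Reindex P h \<beta>)"

definition ex_reindex ::
  "('o, 'm) prod_cat \<Rightarrow> ('o, 'm, 'p) doctrine_data \<Rightarrow> 'm \<Rightarrow> 'o \<times> 'p \<Rightarrow> 'o \<times> 'p" where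
  "ex_reindex C P u = (\<lambda>(B, \<alpha>). (B, Reindex P (prod_ident C u B) \<alpha>))"

definition ex_completion ::
  "('o, 'm) prod_cat \<Rightarrow> ('o, 'm, 'p) doctrine_data \<Rightarrow> ('o, 'm, ('o \<times> 'p) set) doctrine_data" where
  "ex_completion C P =
     \<lparr>Fib = (\<lambda>A. poset_reflection (ex_objects C P A) (ex_le C P A)),
      Reindex = (\<lambda>u. reflect_map (ex_objects C P (Dom C u)) (ex_le C P (Dom C u)) (ex_reindex C P u))\<rparr>"


section \<open>Partial combinatory algebras\<close>

text \<open>The underlying set of the PCA is a whole type; \<open>app a b = None\<close> means that the application is
  undefined. \<open>papp\<close> extends application strictly to possibly undefined terms.\<close>

definition papp :: "('a \<Rightarrow> 'a \<Rightarrow> 'a option) \<Rightarrow> 'a option \<Rightarrow> 'a option \<Rightarrow> 'a option" where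
  "papp app t u = Option.bind t (\<lambda>a. Option.bind u (\<lambda>b. app a b))"

text \<open>The relation \<open>t \<simeq> u\<close> is directed: \<open>t\<close> may be defined where \<open>u\<close> is not.\<close>

definition keq :: "'a option \<Rightarrow> 'a option \<Rightarrow> bool" where
  "keq t u \<longleftrightarrow> (u \<noteq> None \<longrightarrow> t = u)"

definition ks_elements :: "('a \<Rightarrow> 'a \<Rightarrow> 'a option) \<Rightarrow> 'a \<Rightarrow> 'a \<Rightarrow> bool" where
  "ks_elements app k s \<longleftrightarrow>
     (\<forall>a b c.
        app k a \<noteq> None \<and>
        keq (papp app (app k a) (Some b)) (Some a) \<and>
        app s a \<noteq> None \<and>
        papp app (app s a) (Some b) \<noteq> None \<and>
        keq (papp app (papp app (app s a) (Some b)) (Some c)) (papp app (app a c) (app b c)))"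

definition pca :: "('a \<Rightarrow> 'a \<Rightarrow> 'a option) \<Rightarrow> bool" where
  "pca app \<longleftrightarrow> (\<exists>k s. ks_elements app k s)"

definition elementary_sub_pca :: "('a \<Rightarrow> 'a \<Rightarrow> 'a option) \<Rightarrow> 'a set \<Rightarrow> bool" where
  "elementary_sub_pca app A' \<longleftrightarrow>
     (\<forall>a\<in>A'. \<forall>b\<in>A'. \<forall>c. app a b = Some c \<longrightarrow> c \<in> A') \<and>
     (\<exists>k\<in>A'. \<exists>s\<in>A'. ks_elements app k s)"

definition pairing_elements ::
  "('a \<Rightarrow> 'a \<Rightarrow> 'a option) \<Rightarrow> 'a set \<Rightarrow> 'a \<Rightarrow> 'a \<Rightarrow> 'a \<Rightarrow> bool" where
  "pairing_elements app A' pr p1 p2 \<longleftrightarrow>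
     pr \<in> A' \<and> p1 \<in> A' \<and> p2 \<in> A' \<and>
     (\<forall>a b. papp app (Some p1) (papp app (app pr a) (Some b)) = Some a \<and>
            papp app (Some p2) (papp app (app pr a) (Some b)) = Some b)"

definition tuple :: "('a \<Rightarrow> 'a \<Rightarrow> 'a option) \<Rightarrow> 'a \<Rightarrow> 'a \<Rightarrow> 'a \<Rightarrow> 'a" where
  "tuple app pr a b = the (papp app (app pr a) (Some b))"

definition nonempty_subsets :: "'a set set" where
  "nonempty_subsets = {S. S \<noteq> {}}"


section \<open>The category of subsets and computable functions\<close>

definition computable_functions ::
  "('a \<Rightarrow> 'a \<Rightarrow> 'a option) \<Rightarrow> 'a set \<Rightarrow> 'a set \<Rightarrow> 'a set \<Rightarrow> ('a \<Rightarrow> 'a) set" where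
  "computable_functions app A' X Y =
     {f \<in> X \<rightarrow>\<^sub>E Y. \<exists>a\<in>A'. \<forall>x\<in>X. app a x = Some (f x)}"

definition pca_prod :: "('a \<Rightarrow> 'a \<Rightarrow> 'a option) \<Rightarrow> 'a \<Rightarrow> 'a set \<Rightarrow> 'a set \<Rightarrow> 'a set" where
  "pca_prod app pr X Y = {tuple app pr x y | x y. x \<in> X \<and> y \<in> Y}"

type_synonym 'a marrow = "'a set \<times> ('a \<Rightarrow> 'a) \<times> 'a set"

definition Modp ::
  "('a \<Rightarrow> 'a \<Rightarrow> 'a option) \<Rightarrow> 'a set \<Rightarrow> 'a \<Rightarrow> 'a \<Rightarrow> 'a \<Rightarrow> ('a set, 'a marrow) prod_cat" where
  "Modp app A' pr p1 p2 =
     \<lparr>Ob = UNIV,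
      Arr = {(X, f, Y). f \<in> computable_functions app A' X Y},
      Dom = (\<lambda>(X, f, Y). X),
      Cod = (\<lambda>(X, f, Y). Y),
      Ident = (\<lambda>X. (X, \<lambda>x\<in>X. x, X)),
      Comp = (\<lambda>(Y, g, Z) (X, f, Y'). (X, compose X g f, Z)),
      Prod = pca_prod app pr,
      Proj1 = (\<lambda>X Y. (pca_prod app pr X Y, \<lambda>p\<in>pca_prod app pr X Y. the (app p1 p), X)),
      Proj2 = (\<lambda>X Y. (pca_prod app pr X Y, \<lambda>p\<in>pca_prod app pr X Y. the (app p2 p), Y))\<rparr>"


section \<open>The elementary Weihrauch doctrine\<close>

definition eW_objects :: "'a set \<Rightarrow> ('a \<Rightarrow> 'a set) set" where
  "eW_objects X = X \<rightarrow>\<^sub>E nonempty_subsets"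

definition eW_le ::
  "('a \<Rightarrow> 'a \<Rightarrow> 'a option) \<Rightarrow> 'a set \<Rightarrow> 'a \<Rightarrow> 'a set \<Rightarrow> ('a \<Rightarrow> 'a set) \<Rightarrow> ('a \<Rightarrow> 'a set) \<Rightarrow> bool" where
  "eW_le app A' pr X f g \<longleftrightarrow>
     (\<exists>h\<in>A'. \<forall>p\<in>X. \<forall>q\<in>g p. \<exists>r\<in>f p. app h (tuple app pr p q) = Some r)"

definition elem_weihrauch ::
  "('a \<Rightarrow> 'a \<Rightarrow> 'a option) \<Rightarrow> 'a set \<Rightarrow> 'a
    \<Rightarrow> ('a set, 'a marrow, ('a \<Rightarrow> 'a set) set) doctrine_data" where
  "elem_weihrauch app A' pr =
     \<lparr>Fib = (\<lambda>X. poset_reflection (eW_objects X) (eW_le app A' pr X)),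
      Reindex = (\<lambda>(X, u, Y).
        reflect_map (eW_objects X) (eW_le app A' pr X) (\<lambda>f. \<lambda>x\<in>X. f (u x)))\<rparr>"


section \<open>The Weihrauch doctrine\<close>

text \<open>A generalized Weihrauch predicate \<open>F : X \<rightarrow> \<wp>\<^sup>*(A)\<^sup>Y\<close> is represented as \<open>(Y, F)\<close>.\<close>

type_synonym 'a wpred = "'a set \<times> ('a \<Rightarrow> 'a \<Rightarrow> 'a set)"

definition W_objects :: "'a set \<Rightarrow> 'a wpred set" where
  "W_objects X = {(Y, F). F \<in> X \<rightarrow>\<^sub>E (Y \<rightarrow>\<^sub>E nonempty_subsets)}"

definition W_le ::
  "('a \<Rightarrow> 'a \<Rightarrow> 'a option) \<Rightarrow> 'a set \<Rightarrow> 'a \<Rightarrow> 'a set \<Rightarrow> 'a wpred \<Rightarrow> 'a wpred \<Rightarrow> bool" where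
  "W_le app A' pr X = (\<lambda>(Y, F) (Z, G).
     \<exists>k\<in>computable_functions app A' (pca_prod app pr X Y) Z. \<exists>h\<in>A'.
       \<forall>x\<in>X. \<forall>y\<in>Y. \<forall>q\<in>G x (k (tuple app pr x y)).
         \<exists>r\<in>F x y. app h (tuple app pr (tuple app pr x y) q) = Some r)"

definition weihrauch ::
  "('a \<Rightarrow> 'a \<Rightarrow> 'a option) \<Rightarrow> 'a set \<Rightarrow> 'a \<Rightarrow> ('a set, 'a marrow, 'a wpred set) doctrine_data" where
  "weihrauch app A' pr =
     \<lparr>Fib = (\<lambda>X. poset_reflection (W_objects X) (W_le app A' pr X)),
      Reindex = (\<lambda>(X, u, X').
        reflect_map (W_objects X) (W_le app A' pr X) (\<lambda>(Y, F). (Y, \<lambda>x\<in>X. F (u x))))\<rparr>"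


section \<open>The comparison map on representatives\<close>

definition eW_class ::
  "('a \<Rightarrow> 'a \<Rightarrow> 'a option) \<Rightarrow> 'a set \<Rightarrow> 'a \<Rightarrow> 'a set \<Rightarrow> ('a \<Rightarrow> 'a set) \<Rightarrow> ('a \<Rightarrow> 'a set) set" where
  "eW_class app A' pr X = refl_class (eW_objects X) (eW_le app A' pr X)"

definition W_class ::
  "('a \<Rightarrow> 'a \<Rightarrow> 'a option) \<Rightarrow> 'a set \<Rightarrow> 'a \<Rightarrow> 'a set \<Rightarrow> 'a wpred \<Rightarrow> 'a wpred set" where
  "W_class app A' pr X = refl_class (W_objects X) (W_le app A' pr X)"

definition ex_class ::
  "('o, 'm) prod_cat \<Rightarrow> ('o, 'm, 'p) doctrine_data \<Rightarrow> 'o \<Rightarrow> 'o \<times> 'p \<Rightarrow> ('o \<times> 'p) set" where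
  "ex_class C P A = refl_class (ex_objects C P A) (ex_le C P A)"

definition curry_pred ::
  "('a \<Rightarrow> 'a \<Rightarrow> 'a option) \<Rightarrow> 'a \<Rightarrow> 'a set \<Rightarrow> 'a set \<Rightarrow> ('a \<Rightarrow> 'a set) \<Rightarrow> 'a \<Rightarrow> 'a \<Rightarrow> 'a set" where
  "curry_pred app pr X Y f = (\<lambda>x\<in>X. \<lambda>y\<in>Y. f (tuple app pr x y))"

end

theory Submission
  imports Defs
begin

text \<open>Uncurrying sends a generalized Weihrauch predicate \<open>F\<close> with parameter set \<open>Y\<close> to the pair
  consisting of \<open>Y\<close> and the class of \<open>\<langle>x, y\<rangle> \<mapsto> F x y\<close>. This map is onto the pairs that generate the
  pure existential completion and it commutes with reindexing. It preserves and reflects the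
  preorders: an arrow \<open>X \<times> Y \<rightarrow> X \<times> Z\<close> over \<open>X\<close> is the same as a computable function \<open>X \<times> Y \<rightarrow> Z\<close>,
  and under this correspondence the two conditions on the second realizer coincide. Since the
  Weihrauch preorders are easily seen to form a doctrine, so do those of the completion, by transport
  along this map.\<close>

section \<open>Poset reflections\<close>

lemma mutual_equiv:
  assumes "reflp_on S R" and "transp_on S R"
  shows "equiv S (mutual S R)"
proof (rule equivI)
  show "mutual S R \<subseteq> S \<times> S" and "sym (mutual S R)"
    by (auto simp: mutual_def sym_def)
  show "refl_on S (mutual S R)"
    using assms(1) by (auto simp: mutual_def refl_on_def reflp_on_def)
  show "trans (mutual S R)"
    unfolding trans_def mutual_def using assms(2) by (auto dest: transp_onD)
qed

lemma reflection_carrier: "carrier (poset_reflection S R) = refl_class S R ` S"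
  by (auto simp: poset_reflection_def quotient_def refl_class_def)

text \<open>The order of the reflection asks only for some pair of related representatives.
  Transitivity carries such a comparison over to \<open>x\<close> and \<open>y\<close>; for the
  converse, reflexivity places \<open>x\<close> and \<open>y\<close> in their own classes.\<close>

lemma reflection_le:
  assumes "reflp_on S R" and "transp_on S R" and "x \<in> S" and "y \<in> S"
  shows "refl_class S R x \<sqsubseteq>\<^bsub>poset_reflection S R\<^esub> refl_class S R y \<longleftrightarrow> R x y"
proof
  assume "refl_class S R x \<sqsubseteq>\<^bsub>poset_reflection S R\<^esub> refl_class S R y"
  then obtain x' y' where "x' \<in> S" "y' \<in> S" "R x x'" "R x' y'" "R y' y"
    by (auto simp: poset_reflection_def refl_class_def mutual_def)
  then show "R x y"
    using assms by (meson transp_onD)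
next
  assume "R x y"
  moreover have "x \<in> refl_class S R x" "y \<in> refl_class S R y"
    using assms by (auto simp: refl_class_def mutual_def reflp_on_def)
  ultimately show "refl_class S R x \<sqsubseteq>\<^bsub>poset_reflection S R\<^esub> refl_class S R y"
    by (auto simp: poset_reflection_def)
qed

lemma refl_class_eq_iff:
  assumes "reflp_on S R" and "transp_on S R" and "x \<in> S" and "y \<in> S"
  shows "refl_class S R x = refl_class S R y \<longleftrightarrow> R x y \<and> R y x"
  using eq_equiv_class_iff[OF mutual_equiv[OF assms(1,2)] assms(3,4)] assms(3,4)
  by (simp add: refl_class_def mutual_def)

lemma reflection_partial_order:
  assumes "reflp_on S R" and "transp_on S R"
  shows "partial_order (poset_reflection S R)"
proof -
  let ?L = "poset_reflection S R"
  have eq: "(.=\<^bsub>?L\<^esub>) = (=)"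
    by (simp add: poset_reflection_def)
  note le = reflection_le[OF assms]
  show ?thesis
  proof
    fix c assume "c \<in> carrier ?L"
    then show "c \<sqsubseteq>\<^bsub>?L\<^esub> c"
      using assms(1) by (auto simp: reflection_carrier le reflp_on_def)
  next
    fix c d assume "c \<sqsubseteq>\<^bsub>?L\<^esub> d" "d \<sqsubseteq>\<^bsub>?L\<^esub> c" "c \<in> carrier ?L" "d \<in> carrier ?L"
    moreover from this obtain x y
      where "x \<in> S" "y \<in> S" "c = refl_class S R x" "d = refl_class S R y"
      by (auto simp: reflection_carrier)
    ultimately show "c .=\<^bsub>?L\<^esub> d"
      by (simp add: eq le refl_class_eq_iff[OF assms])
  next
    fix b c d
    assume "b \<sqsubseteq>\<^bsub>?L\<^esub> c" "c \<sqsubseteq>\<^bsub>?L\<^esub> d" "b \<in> carrier ?L" "c \<in> carrier ?L" "d \<in> carrier ?L"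
    moreover from this obtain x y z where "x \<in> S" "y \<in> S" "z \<in> S"
      "b = refl_class S R x" "c = refl_class S R y" "d = refl_class S R z"
      by (auto simp: reflection_carrier)
    ultimately show "b \<sqsubseteq>\<^bsub>?L\<^esub> d"
      using transp_onD[OF assms(2), of x y z] by (simp add: le)
  qed (auto simp: eq)
qed

text \<open>Monotonicity sends mutually related elements to mutually related ones, so all classes in
  the union defining \<open>reflect_map\<close> agree. The union is not empty, since
  \<open>x\<close> lies in its own class.\<close>

lemma reflect_map_class:
  assumes S: "reflp_on S R" and T: "reflp_on T R'" "transp_on T R'"
    and closed: "\<And>x. x \<in> S \<Longrightarrow> \<phi> x \<in> T"
    and mono: "\<And>x y. x \<in> S \<Longrightarrow> y \<in> S \<Longrightarrow> R x y \<Longrightarrow> R' (\<phi> x) (\<phi> y)"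
    and x: "x \<in> S"
  shows "reflect_map T R' \<phi> (refl_class S R x) = refl_class T R' (\<phi> x)"
proof -
  have "refl_class T R' (\<phi> y) = refl_class T R' (\<phi> x)" if "y \<in> refl_class S R x" for y
    using that by (auto simp: refl_class_def[of S] mutual_def refl_class_eq_iff[OF T] closed mono)
  moreover have "x \<in> refl_class S R x"
    using S x by (auto simp: refl_class_def mutual_def reflp_on_def)
  ultimately show ?thesis
    unfolding reflect_map_def by blast
qed

text \<open>Injectivity on classes comes from the order being reflected: if the images of two
  elements are mutually related, then so are the elements. Surjectivity on classes follows from
  surjectivity on representatives.\<close>

lemma reflect_map_poset_isomorphism:
  assumes S: "reflp_on S R" "transp_on S R" and T: "reflp_on T R'" "transp_on T R'"
    and onto: "\<chi> ` S = T"
    and le: "\<And>x y. x \<in> S \<Longrightarrow> y \<in> S \<Longrightarrow> R' (\<chi> x) (\<chi> y) \<longleftrightarrow> R x y"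
  shows "poset_isomorphism (poset_reflection S R) (poset_reflection T R') (reflect_map T R' \<chi>)"
proof -
  have mem: "\<chi> x \<in> T" if "x \<in> S" for x
    using that onto by blast
  have cls: "reflect_map T R' \<chi> (refl_class S R x) = refl_class T R' (\<chi> x)" if "x \<in> S" for x
    using that by (intro reflect_map_class S T) (auto simp: le mem)
  have "inj_on (reflect_map T R' \<chi>) (refl_class S R ` S)"
    by (auto simp: inj_on_def cls refl_class_eq_iff[OF T] refl_class_eq_iff[OF S] le mem)
  moreover have "reflect_map T R' \<chi> ` refl_class S R ` S = refl_class T R' ` T"
  proof -
    have "reflect_map T R' \<chi> ` refl_class S R ` S = (\<lambda>x. refl_class T R' (\<chi> x)) ` S"
      unfolding image_image using cls by (intro image_cong) auto
    also have "\<dots> = refl_class T R' ` \<chi> ` S"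
      by (simp add: image_image)
    finally show ?thesis
      by (simp add: onto)
  qed
  ultimately show ?thesis
    unfolding poset_isomorphism_def bij_betw_def
    by (auto simp: reflection_carrier cls le mem reflection_le[OF S] reflection_le[OF T]
        reflection_partial_order[OF S] reflection_partial_order[OF T])
qed

section \<open>Doctrines presented by preorders\<close>

text \<open>The common shape of the elementary Weihrauch doctrine, the Weihrauch doctrine and the
  completion, so that the laws of a doctrine are derived once from laws on representatives.\<close>

definition reflected_doctrine ::
  "('o, 'm) prod_cat \<Rightarrow> ('o \<Rightarrow> 'b set) \<Rightarrow> ('o \<Rightarrow> 'b \<Rightarrow> 'b \<Rightarrow> bool) \<Rightarrow> ('m \<Rightarrow> 'b \<Rightarrow> 'b)
    \<Rightarrow> ('o, 'm, 'b set) doctrine_data" where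
  "reflected_doctrine C S R r =
     \<lparr>Fib = (\<lambda>A. poset_reflection (S A) (R A)),
      Reindex = (\<lambda>u. reflect_map (S (Dom C u)) (R (Dom C u)) (r u))\<rparr>"

text \<open>The two functor laws are demanded as equations between representatives, not merely up to
  mutual comparability. For the Weihrauch preorders this works because predicates are extensional
  functions.\<close>

locale preorder_doctrine = category_with_products C
  for C :: "('o, 'm) prod_cat" and S :: "'o \<Rightarrow> 'b set" and R :: "'o \<Rightarrow> 'b \<Rightarrow> 'b \<Rightarrow> bool"
    and r :: "'m \<Rightarrow> 'b \<Rightarrow> 'b" +
  assumes refl: "A \<in> Ob C \<Longrightarrow> reflp_on (S A) (R A)"
    and trans: "A \<in> Ob C \<Longrightarrow> transp_on (S A) (R A)"
    and closed: "u \<in> Hom C A B \<Longrightarrow> x \<in> S B \<Longrightarrow> r u x \<in> S A"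
    and mono: "u \<in> Hom C A B \<Longrightarrow> x \<in> S B \<Longrightarrow> y \<in> S B \<Longrightarrow> R B x y \<Longrightarrow> R A (r u x) (r u y)"
    and reindex_Ident: "A \<in> Ob C \<Longrightarrow> x \<in> S A \<Longrightarrow> r (Ident C A) x = x"
    and reindex_Comp: "u \<in> Hom C A B \<Longrightarrow> v \<in> Hom C B D \<Longrightarrow> x \<in> S D \<Longrightarrow>
           r (Comp C v u) x = r u (r v x)"
begin

lemma Hom_Ob: "u \<in> Hom C A B \<Longrightarrow> A \<in> Ob C" "u \<in> Hom C A B \<Longrightarrow> B \<in> Ob C"
  using Dom_closed Cod_closed by (auto simp: Hom_def)

lemma Fib_carrier: "carrier (Fib (reflected_doctrine C S R r) A) = refl_class (S A) (R A) ` S A"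
  by (simp add: reflected_doctrine_def reflection_carrier)

lemma Fib_le:
  assumes "A \<in> Ob C" and "x \<in> S A" and "y \<in> S A"
  shows "refl_class (S A) (R A) x \<sqsubseteq>\<^bsub>Fib (reflected_doctrine C S R r) A\<^esub> refl_class (S A) (R A) y
    \<longleftrightarrow> R A x y"
  using assms by (simp add: reflected_doctrine_def reflection_le refl trans)

lemma Reindex_class:
  assumes u: "u \<in> Hom C A B" and x: "x \<in> S B"
  shows "Reindex (reflected_doctrine C S R r) u (refl_class (S B) (R B) x)
    = refl_class (S A) (R A) (r u x)"
proof -
  have "Dom C u = A"
    using u by (simp add: Hom_def)
  moreover have "reflect_map (S A) (R A) (r u) (refl_class (S B) (R B) x)
      = refl_class (S A) (R A) (r u x)"
    by (intro reflect_map_class refl trans) (use Hom_Ob[OF u] closed[OF u] mono[OF u] x in auto)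
  ultimately show ?thesis
    by (simp add: reflected_doctrine_def)
qed

lemma doctrine_reflected: "doctrine C (reflected_doctrine C S R r)"
proof (intro doctrine.intro doctrine_axioms.intro)
  show "category_with_products C" ..
  let ?P = "reflected_doctrine C S R r"
  show "partial_order (Fib ?P A)" if "A \<in> Ob C" for A
    using reflection_partial_order[OF refl[OF that] trans[OF that]]
    by (simp add: reflected_doctrine_def)
  show "Reindex ?P u \<alpha> \<in> carrier (Fib ?P A)" if "u \<in> Hom C A B" "\<alpha> \<in> carrier (Fib ?P B)" for u A B \<alpha>
    using that by (auto simp: Fib_carrier Reindex_class closed)
  show "Reindex ?P u \<alpha> \<sqsubseteq>\<^bsub>Fib ?P A\<^esub> Reindex ?P u \<beta>"
    if "u \<in> Hom C A B" "\<alpha> \<in> carrier (Fib ?P B)" "\<beta> \<in> carrier (Fib ?P B)" "\<alpha> \<sqsubseteq>\<^bsub>Fib ?P B\<^esub> \<beta>"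
    for u A B \<alpha> \<beta>
    using that Hom_Ob[OF that(1)]
    by (auto simp: Fib_carrier Reindex_class[OF that(1)] Fib_le closed[OF that(1)] mono[OF that(1)])
  show "Reindex ?P (Ident C A) \<alpha> = \<alpha>" if "A \<in> Ob C" "\<alpha> \<in> carrier (Fib ?P A)" for A \<alpha>
    using that by (auto simp: Fib_carrier Reindex_class[OF Ident_Hom] reindex_Ident)
  show "Reindex ?P (Comp C v u) \<alpha> = Reindex ?P u (Reindex ?P v \<alpha>)"
    if "u \<in> Hom C A B" "v \<in> Hom C B D" "\<alpha> \<in> carrier (Fib ?P D)" for u v A B D \<alpha>
    using that
    by (auto simp: Fib_carrier Reindex_class[OF Comp_Hom] Reindex_class[OF that(1)]
        Reindex_class[OF that(2)] closed reindex_Comp)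
qed

text \<open>Every element of \<open>T A\<close> is the image of an element of \<open>S A\<close>, so
  each law for \<open>T\<close> is the corresponding law for \<open>S\<close> read through \<chi>.
  The same data then induce an isomorphism of the reflected doctrines.\<close>

lemma transport:
  fixes T :: "'o \<Rightarrow> 'c set" and R' :: "'o \<Rightarrow> 'c \<Rightarrow> 'c \<Rightarrow> bool" and r' :: "'m \<Rightarrow> 'c \<Rightarrow> 'c"
    and \<chi> :: "'o \<Rightarrow> 'b \<Rightarrow> 'c"
  assumes onto: "\<And>A. A \<in> Ob C \<Longrightarrow> \<chi> A ` S A = T A"
    and le: "\<And>A x y. A \<in> Ob C \<Longrightarrow> x \<in> S A \<Longrightarrow> y \<in> S A \<Longrightarrow> R' A (\<chi> A x) (\<chi> A y) \<longleftrightarrow> R A x y"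
    and natural: "\<And>A B u x. u \<in> Hom C A B \<Longrightarrow> x \<in> S B \<Longrightarrow> r' u (\<chi> B x) = \<chi> A (r u x)"
  shows "preorder_doctrine C T R' r'"
    and "doctrine_isomorphism C (reflected_doctrine C S R r) (reflected_doctrine C T R' r')
      (\<lambda>A. reflect_map (T A) (R' A) (\<chi> A))"
proof -
  show T: "preorder_doctrine C T R' r'"
  proof
    fix A assume A: "A \<in> Ob C"
    show "reflp_on (T A) (R' A)"
      using refl[OF A] unfolding onto[OF A, symmetric] by (auto simp: reflp_on_def le[OF A])
    show "transp_on (T A) (R' A)"
    proof (rule transp_onI)
      fix x y z assume "x \<in> T A" "y \<in> T A" "z \<in> T A" and R': "R' A x y" "R' A y z"
      then obtain x' y' z' where "x = \<chi> A x'" "y = \<chi> A y'" "z = \<chi> A z'"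
        and xyz: "x' \<in> S A" "y' \<in> S A" "z' \<in> S A"
        unfolding onto[OF A, symmetric] by blast
      with R' show "R' A x z"
        using transp_onD[OF trans[OF A] xyz] by (simp add: le A)
    qed
    show "r' (Ident C A) x = x" if "x \<in> T A" for x
      using that unfolding onto[OF A, symmetric]
      by (auto simp: natural[OF Ident_Hom[OF A]] reindex_Ident[OF A])
  next
    fix A B u assume u: "u \<in> Hom C A B"
    note AB = Hom_Ob[OF u]
    show "r' u x \<in> T A" if "x \<in> T B" for x
      using that closed[OF u] unfolding onto[OF AB(1), symmetric] onto[OF AB(2), symmetric]
      by (auto simp: natural[OF u])
    show "R' A (r' u x) (r' u y)" if xy: "x \<in> T B" "y \<in> T B" "R' B x y" for x y
    proof -
      obtain x' y' where "x = \<chi> B x'" "y = \<chi> B y'" "x' \<in> S B" "y' \<in> S B"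
        using xy(1,2) unfolding onto[OF AB(2), symmetric] by blast
      with xy(3) show ?thesis
        using closed[OF u] mono[OF u] by (simp add: natural[OF u] le AB)
    qed
    show "r' (Comp C v u) x = r' u (r' v x)" if v: "v \<in> Hom C B D" and x: "x \<in> T D" for v D x
      using x closed[OF v] unfolding onto[OF Hom_Ob(2)[OF v], symmetric]
      by (auto simp: natural[OF u] natural[OF v] natural[OF Comp_Hom[OF u v]] reindex_Comp[OF u v])
  qed
  interpret T: preorder_doctrine C T R' r' by (fact T)
  have cls: "reflect_map (T A) (R' A) (\<chi> A) (refl_class (S A) (R A) x)
      = refl_class (T A) (R' A) (\<chi> A x)" if "A \<in> Ob C" "x \<in> S A" for A x
    using that onto[OF that(1)] le[OF that(1)]
    by (intro reflect_map_class refl trans T.refl T.trans) auto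
  have "poset_isomorphism (Fib (reflected_doctrine C S R r) A) (Fib (reflected_doctrine C T R' r') A)
      (reflect_map (T A) (R' A) (\<chi> A))" if "A \<in> Ob C" for A
    using reflect_map_poset_isomorphism[OF refl trans T.refl T.trans onto le, of A] that
    by (simp add: reflected_doctrine_def)
  moreover have "reflect_map (T A) (R' A) (\<chi> A) (Reindex (reflected_doctrine C S R r) u \<alpha>)
      = Reindex (reflected_doctrine C T R' r') u (reflect_map (T B) (R' B) (\<chi> B) \<alpha>)"
    if u: "u \<in> Hom C A B" and \<alpha>: "\<alpha> \<in> carrier (Fib (reflected_doctrine C S R r) B)" for A B u \<alpha>
  proof -
    note AB = Hom_Ob[OF u]
    obtain x where x: "x \<in> S B" "\<alpha> = refl_class (S B) (R B) x"
      using \<alpha> by (auto simp: Fib_carrier)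
    then have "\<chi> B x \<in> T B"
      using onto[OF AB(2)] by blast
    then show ?thesis
      using x by (simp add: Reindex_class[OF u] T.Reindex_class[OF u] cls AB closed[OF u] natural[OF u])
  qed
  ultimately show "doctrine_isomorphism C (reflected_doctrine C S R r) (reflected_doctrine C T R' r')
      (\<lambda>A. reflect_map (T A) (R' A) (\<chi> A))"
    unfolding doctrine_isomorphism_def using doctrine_reflected T.doctrine_reflected by blast
qed

end

section \<open>Inverses of isomorphisms of posets and doctrines\<close>

lemma poset_isomorphism_inverse:
  assumes "poset_isomorphism L M \<phi>"
  shows "poset_isomorphism M L (inv_into (carrier L) \<phi>)"
proof -
  let ?\<psi> = "inv_into (carrier L) \<phi>"
  have bij: "bij_betw \<phi> (carrier L) (carrier M)"
    using assms by (simp add: poset_isomorphism_def)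
  have "?\<psi> y \<in> carrier L" "\<phi> (?\<psi> y) = y" if "y \<in> carrier M" for y
    using bij that by (auto simp: bij_betw_def inv_into_into f_inv_into_f)
  then show ?thesis
    using assms bij_betw_inv_into[OF bij] by (simp add: poset_isomorphism_def)
qed

text \<open>Uncurrying leads from Weihrauch predicates to the completion, while currying, the map to
  be described, leads back. Naturality of the inverse is obtained by writing \<beta> as the image of
  some \<alpha> and cancelling the bijections.\<close>

lemma doctrine_isomorphism_inverse:
  assumes "doctrine_isomorphism C P Q \<phi>"
  shows "doctrine_isomorphism C Q P (\<lambda>A. inv_into (carrier (Fib P A)) (\<phi> A))"
proof -
  interpret P: doctrine C P
    using assms by (simp add: doctrine_isomorphism_def)
  let ?\<psi> = "\<lambda>A. inv_into (carrier (Fib P A)) (\<phi> A)"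
  have iso: "poset_isomorphism (Fib P A) (Fib Q A) (\<phi> A)" if "A \<in> Ob C" for A
    using assms that by (simp add: doctrine_isomorphism_def)
  have bij: "bij_betw (\<phi> A) (carrier (Fib P A)) (carrier (Fib Q A))" if "A \<in> Ob C" for A
    using iso[OF that] by (simp add: poset_isomorphism_def)
  have "?\<psi> A (Reindex Q u \<beta>) = Reindex P u (?\<psi> B \<beta>)"
    if AB: "A \<in> Ob C" "B \<in> Ob C" and u: "u \<in> Hom C A B" and \<beta>: "\<beta> \<in> carrier (Fib Q B)"
    for A B u \<beta>
  proof -
    obtain \<alpha> where \<alpha>: "\<alpha> \<in> carrier (Fib P B)" "\<beta> = \<phi> B \<alpha>"
      using bij[OF AB(2)] \<beta> by (auto simp: bij_betw_def)
    have "Reindex Q u \<beta> = \<phi> A (Reindex P u \<alpha>)"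
      using assms AB u \<alpha> by (simp add: doctrine_isomorphism_def)
    then show ?thesis
      using \<alpha> P.Reindex_closed[OF u \<alpha>(1)] bij[OF AB(1)] bij[OF AB(2)]
      by (simp add: bij_betw_def)
  qed
  then show ?thesis
    using assms poset_isomorphism_inverse[OF iso] by (simp add: doctrine_isomorphism_def)
qed

section \<open>Realizers and the category of subsets\<close>

locale sub_pca_with_pairing =
  fixes app :: "'a \<Rightarrow> 'a \<Rightarrow> 'a option" and A' :: "'a set" and pr p1 p2 :: 'a
  assumes sub_pca: "elementary_sub_pca app A'"
    and pairing: "pairing_elements app A' pr p1 p2"
begin

abbreviation tup :: "'a \<Rightarrow> 'a \<Rightarrow> 'a" where
  "tup \<equiv> tuple app pr"

abbreviation pfst :: "'a \<Rightarrow> 'a" where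
  "pfst p \<equiv> the (app p1 p)"

abbreviation psnd :: "'a \<Rightarrow> 'a" where
  "psnd p \<equiv> the (app p2 p)"

abbreviation times :: "'a set \<Rightarrow> 'a set \<Rightarrow> 'a set" (infixr \<open>\<otimes>\<close> 70) where
  "X \<otimes> Y \<equiv> pca_prod app pr X Y"

abbreviation computable :: "'a set \<Rightarrow> 'a set \<Rightarrow> ('a \<Rightarrow> 'a) set" where
  "computable \<equiv> computable_functions app A'"

abbreviation "M \<equiv> Modp app A' pr p1 p2"

abbreviation "E \<equiv> elem_weihrauch app A' pr"

lemma pairing_mem: "pr \<in> A'" "p1 \<in> A'" "p2 \<in> A'"
  using pairing by (auto simp: pairing_elements_def)

text \<open>Strictness forces the pair to be defined: applying \<open>p1\<close> to it yields a
  value. Hence \<open>the\<close> in \<open>tuple\<close> picks a genuine result.\<close>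

lemma tuple_app: "papp app (app pr a) (Some b) = Some (tup a b)"
proof -
  have "papp app (Some p1) (papp app (app pr a) (Some b)) = Some a"
    using pairing by (auto simp: pairing_elements_def)
  then show ?thesis
    by (auto simp: tuple_def papp_def bind_eq_Some_conv)
qed

lemma proj_tup [simp]: "app p1 (tup a b) = Some a" "app p2 (tup a b) = Some b"
proof -
  have "papp app (Some p1) (papp app (app pr a) (Some b)) = Some a"
    "papp app (Some p2) (papp app (app pr a) (Some b)) = Some b"
    using pairing by (auto simp: pairing_elements_def)
  then show "app p1 (tup a b) = Some a" "app p2 (tup a b) = Some b"
    unfolding tuple_app by (simp_all add: papp_def)
qed

lemma pairE:
  assumes "p \<in> X \<otimes> Y"
  obtains x y where "x \<in> X" "y \<in> Y" "p = tup x y"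
  using assms by (auto simp: pca_prod_def)

lemma tup_eq_iff [simp]: "tup x y = tup x' y' \<longleftrightarrow> x = x' \<and> y = y'"
  by (metis option.inject proj_tup)

lemma tup_mem [simp]: "tup x y \<in> X \<otimes> Y \<longleftrightarrow> x \<in> X \<and> y \<in> Y"
  by (auto simp: pca_prod_def)

section \<open>Realizers built from the combinators\<close>

lemma const_realizer:
  assumes "a \<in> A'"
  obtains c where "c \<in> A'" "\<And>x. app c x = Some a"
proof -
  obtain k s where ks: "k \<in> A'" "ks_elements app k s"
    using sub_pca unfolding elementary_sub_pca_def by blast
  have "app k a \<noteq> None"
    using ks(2) unfolding ks_elements_def by blast
  then obtain c where c: "app k a = Some c"
    by blast
  show thesis
  proof
    show "c \<in> A'"
      using c ks(1) assms sub_pca unfolding elementary_sub_pca_def by blast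
    have "keq (papp app (app k a) (Some x)) (Some a)" for x
      using ks(2) unfolding ks_elements_def by blast
    then show "app c x = Some a" for x
      by (simp add: c keq_def papp_def)
  qed
qed

text \<open>The element is \<open>s a b\<close>. The conclusion is an implication because
  \<open>keq\<close> constrains the left side only where the right side is defined.\<close>

lemma app_realizer:
  assumes "a \<in> A'" and "b \<in> A'"
  obtains c where "c \<in> A'"
    "\<And>x y z w. app a x = Some y \<Longrightarrow> app b x = Some z \<Longrightarrow> app y z = Some w \<Longrightarrow> app c x = Some w"
proof -
  obtain k s where ks: "s \<in> A'" "ks_elements app k s"
    using sub_pca unfolding elementary_sub_pca_def by blast
  have "app s a \<noteq> None" "papp app (app s a) (Some b) \<noteq> None"
    using ks(2) unfolding ks_elements_def by blast+
  then obtain sa c where c: "app s a = Some sa" "app sa b = Some c"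
    by (auto simp: papp_def)
  show thesis
  proof
    show "c \<in> A'"
      using c ks(1) assms sub_pca unfolding elementary_sub_pca_def by blast
    fix x y z w assume xyzw: "app a x = Some y" "app b x = Some z" "app y z = Some w"
    have "keq (papp app (papp app (app s a) (Some b)) (Some x)) (papp app (app a x) (app b x))"
      using ks(2) unfolding ks_elements_def by blast
    then show "app c x = Some w"
      by (simp add: c xyzw keq_def papp_def)
  qed
qed

text \<open>The usual \<open>s k k\<close>: if \<open>y\<close> is the value of \<open>k x\<close>,
  then \<open>k x y\<close> is \<open>x\<close>.\<close>

lemma id_realizer:
  obtains c where "c \<in> A'" "\<And>x. app c x = Some x"
proof -
  obtain k s where ks: "k \<in> A'" "ks_elements app k s"
    using sub_pca unfolding elementary_sub_pca_def by blast
  obtain c where c: "c \<in> A'"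
    "\<And>x y z w. app k x = Some y \<Longrightarrow> app k x = Some z \<Longrightarrow> app y z = Some w \<Longrightarrow> app c x = Some w"
    by (rule app_realizer[OF ks(1) ks(1)]) blast
  have "app c x = Some x" for x
  proof -
    have "app k x \<noteq> None"
      using ks(2) unfolding ks_elements_def by blast
    then obtain y where y: "app k x = Some y" by auto
    have "keq (papp app (app k x) (Some y)) (Some x)"
      using ks(2) unfolding ks_elements_def by blast
    then show ?thesis
      using c(2)[OF y y] by (simp add: y keq_def papp_def)
  qed
  with c(1) show thesis
    by (rule that)
qed

text \<open>The element is \<open>s (k a) b\<close>.\<close>

lemma comp_realizer:
  assumes "a \<in> A'" and "b \<in> A'"
  obtains c where "c \<in> A'" "\<And>x y z. app b x = Some y \<Longrightarrow> app a y = Some z \<Longrightarrow> app c x = Some z"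
proof -
  obtain a' where a': "a' \<in> A'" "\<And>x. app a' x = Some a"
    by (rule const_realizer[OF assms(1)]) blast
  from app_realizer[OF a'(1) assms(2)] show thesis
    using that a'(2) by metis
qed

text \<open>The element is \<open>s (s (k pr) a) b\<close>, which sends \<open>x\<close> to
  \<open>pr (a x) (b x)\<close>.\<close>

lemma tup_realizer:
  assumes "a \<in> A'" and "b \<in> A'"
  obtains c where "c \<in> A'"
    "\<And>x y z. app a x = Some y \<Longrightarrow> app b x = Some z \<Longrightarrow> app c x = Some (tup y z)"
proof -
  obtain a' where a': "a' \<in> A'" "\<And>x y z. app a x = Some y \<Longrightarrow> app pr y = Some z \<Longrightarrow> app a' x = Some z"
    by (rule comp_realizer[OF pairing_mem(1) assms(1)]) blast
  obtain c where c: "c \<in> A'"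
    "\<And>x y z w. app a' x = Some y \<Longrightarrow> app b x = Some z \<Longrightarrow> app y z = Some w \<Longrightarrow> app c x = Some w"
    by (rule app_realizer[OF a'(1) assms(2)]) blast
  have "app c x = Some (tup y z)" if "app a x = Some y" "app b x = Some z" for x y z
  proof -
    \<comment> \<open>The partial application of \<open>pr\<close> to \<open>y\<close> is defined
      because the full pair is.\<close>
    obtain w where "app pr y = Some w" "app w z = Some (tup y z)"
      using tuple_app[of y z] by (auto simp: papp_def bind_eq_Some_conv)
    then show ?thesis
      using that a'(2) c(2) by blast
  qed
  with c(1) show thesis
    by (rule that)
qed

section \<open>Computable functions and their closure properties\<close>

lemma computableI:
  assumes "a \<in> A'" and "\<And>x. x \<in> X \<Longrightarrow> app a x = Some (f x)" and "f \<in> X \<rightarrow>\<^sub>E Y"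
  shows "f \<in> computable X Y"
  using assms by (auto simp: computable_functions_def)

lemma computableE:
  assumes "f \<in> computable X Y"
  obtains a where "a \<in> A'" "\<And>x. x \<in> X \<Longrightarrow> app a x = Some (f x)"
  using assms by (auto simp: computable_functions_def)

lemma computable_mem: "f \<in> computable X Y \<Longrightarrow> x \<in> X \<Longrightarrow> f x \<in> Y"
  by (auto simp: computable_functions_def)

lemma computable_PiE: "f \<in> computable X Y \<Longrightarrow> f \<in> X \<rightarrow>\<^sub>E Y"
  by (auto simp: computable_functions_def)

lemma id_computable: "(\<lambda>x\<in>X. x) \<in> computable X X"
proof -
  obtain c where "c \<in> A'" "\<And>x. app c x = Some x"
    by (rule id_realizer) blast
  then show ?thesis
    by (intro computableI[of c]) auto
qed

lemma const_computable:
  assumes "a \<in> A'" and "a \<in> Y"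
  shows "(\<lambda>x\<in>X. a) \<in> computable X Y"
proof -
  obtain c where "c \<in> A'" "\<And>x. app c x = Some a"
    by (rule const_realizer[OF assms(1)]) blast
  with assms(2) show ?thesis
    by (intro computableI[of c]) auto
qed

lemma comp_computable:
  assumes f: "f \<in> computable X Y" and g: "g \<in> computable Y Z"
  shows "compose X g f \<in> computable X Z"
proof -
  obtain a where a: "a \<in> A'" "\<And>x. x \<in> X \<Longrightarrow> app a x = Some (f x)"
    by (rule computableE[OF f]) blast
  obtain b where b: "b \<in> A'" "\<And>y. y \<in> Y \<Longrightarrow> app b y = Some (g y)"
    by (rule computableE[OF g]) blast
  obtain c where "c \<in> A'" "\<And>x y z. app a x = Some y \<Longrightarrow> app b y = Some z \<Longrightarrow> app c x = Some z"
    by (rule comp_realizer[OF b(1) a(1)]) blast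
  with a b show ?thesis
    using computable_mem[OF f] computable_mem[OF g]
    by (intro computableI[of c]) (auto simp: compose_def)
qed

lemma tup_computable:
  assumes f: "f \<in> computable Z X" and g: "g \<in> computable Z Y"
  shows "(\<lambda>z\<in>Z. tup (f z) (g z)) \<in> computable Z (X \<otimes> Y)"
proof -
  obtain a where a: "a \<in> A'" "\<And>z. z \<in> Z \<Longrightarrow> app a z = Some (f z)"
    by (rule computableE[OF f]) blast
  obtain b where b: "b \<in> A'" "\<And>z. z \<in> Z \<Longrightarrow> app b z = Some (g z)"
    by (rule computableE[OF g]) blast
  obtain c where "c \<in> A'" "\<And>x y z. app a x = Some y \<Longrightarrow> app b x = Some z \<Longrightarrow> app c x = Some (tup y z)"
    by (rule tup_realizer[OF a(1) b(1)]) blast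
  with a b show ?thesis
    using computable_mem[OF f] computable_mem[OF g]
    by (intro computableI[of c]) auto
qed

lemma pfst_computable: "(\<lambda>p\<in>X \<otimes> Y. pfst p) \<in> computable (X \<otimes> Y) X"
  by (rule computableI[OF pairing_mem(2)]) (auto elim!: pairE)

lemma psnd_computable: "(\<lambda>p\<in>X \<otimes> Y. psnd p) \<in> computable (X \<otimes> Y) Y"
  by (rule computableI[OF pairing_mem(3)]) (auto elim!: pairE)

section \<open>Subsets and computable functions as a category with finite products\<close>

lemma Modp_simps [simp]:
  "Ob M = UNIV"
  "Dom M (X, f, Y) = X"
  "Cod M (X, f, Y) = Y"
  "Ident M X = (X, \<lambda>x\<in>X. x, X)"
  "Comp M (Y, g, Z) (X, f, Y') = (X, compose X g f, Z)"
  "Prod M X Y = X \<otimes> Y"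
  "Proj1 M X Y = (X \<otimes> Y, \<lambda>p\<in>X \<otimes> Y. pfst p, X)"
  "Proj2 M X Y = (X \<otimes> Y, \<lambda>p\<in>X \<otimes> Y. psnd p, Y)"
  by (simp_all add: Modp_def)

lemma Hom_Modp: "Hom M X Y = {(X, f, Y) | f. f \<in> computable X Y}"
  by (auto simp: Hom_def Modp_def)

lemma Hom_Modp_iff [simp]: "(X', f, Y') \<in> Hom M X Y \<longleftrightarrow> X' = X \<and> Y' = Y \<and> f \<in> computable X Y"
  by (auto simp: Hom_Modp)

lemma Hom_ModpE:
  assumes "u \<in> Hom M X Y"
  obtains f where "u = (X, f, Y)" "f \<in> computable X Y"
  using assms by (auto simp: Hom_Modp)

text \<open>Existence is pairing of realizers. Uniqueness holds because every element of the product
  is a pair and a pair is determined by its projections.\<close>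

lemma Modp_Prod_universal:
  assumes "f \<in> Hom M Z X" and "g \<in> Hom M Z Y"
  shows "\<exists>!h. h \<in> Hom M Z (Prod M X Y) \<and> Comp M (Proj1 M X Y) h = f \<and> Comp M (Proj2 M X Y) h = g"
proof -
  obtain f' where f: "f = (Z, f', X)" "f' \<in> computable Z X"
    using assms(1) by (elim Hom_ModpE)
  obtain g' where g: "g = (Z, g', Y)" "g' \<in> computable Z Y"
    using assms(2) by (elim Hom_ModpE)
  have f'g': "f' \<in> extensional Z" "g' \<in> extensional Z"
    using computable_PiE[OF f(2)] computable_PiE[OF g(2)] by (auto simp: PiE_def)
  let ?h = "\<lambda>z\<in>Z. tup (f' z) (g' z)"
  have h: "?h \<in> computable Z (X \<otimes> Y)"
    using f(2) g(2) by (rule tup_computable)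
  show ?thesis
  proof
    have "compose Z (\<lambda>p\<in>X \<otimes> Y. pfst p) ?h = f'" "compose Z (\<lambda>p\<in>X \<otimes> Y. psnd p) ?h = g'"
      using f'g' computable_mem[OF f(2)] computable_mem[OF g(2)]
      by (auto simp: compose_def fun_eq_iff extensional_def)
    with h show "(Z, ?h, X \<otimes> Y) \<in> Hom M Z (Prod M X Y) \<and>
        Comp M (Proj1 M X Y) (Z, ?h, X \<otimes> Y) = f \<and> Comp M (Proj2 M X Y) (Z, ?h, X \<otimes> Y) = g"
      by (simp add: f(1) g(1))
  next
    fix h assume hyp: "h \<in> Hom M Z (Prod M X Y) \<and>
        Comp M (Proj1 M X Y) h = f \<and> Comp M (Proj2 M X Y) h = g"
    then obtain h' where h': "h = (Z, h', X \<otimes> Y)" "h' \<in> computable Z (X \<otimes> Y)"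
      by (auto elim: Hom_ModpE)
    have "h' z = ?h z" if z: "z \<in> Z" for z
    proof -
      obtain x y where xy: "x \<in> X" "y \<in> Y" "h' z = tup x y"
        using computable_mem[OF h'(2) z] by (auto elim: pairE)
      have "compose Z (\<lambda>p\<in>X \<otimes> Y. pfst p) h' z = f' z" "compose Z (\<lambda>p\<in>X \<otimes> Y. psnd p) h' z = g' z"
        using hyp by (simp_all add: h'(1) f(1) g(1))
      then show ?thesis
        using xy z by (simp add: compose_def)
    qed
    \<comment> \<open>Outside \<open>Z\<close> both functions take the default value of extensional
      functions.\<close>
    then have "h' = ?h"
      by (rule PiE_ext[OF computable_PiE[OF h'(2)] computable_PiE[OF h]])
    then show "h = (Z, ?h, X \<otimes> Y)"
      by (simp add: h'(1))
  qed
qed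

lemma Modp_terminal: "\<exists>T\<in>Ob M. \<forall>X\<in>Ob M. \<exists>!f. f \<in> Hom M X T"
proof
  \<comment> \<open>Constant maps into the terminal object need a realizer in \<open>A'\<close>, so
    its point is taken from \<open>A'\<close>; \<open>pr\<close> is one at hand.\<close>
  show "{pr} \<in> Ob M" by simp
  show "\<forall>X\<in>Ob M. \<exists>!f. f \<in> Hom M X {pr}"
  proof
    fix X :: "'a set"
    show "\<exists>!f. f \<in> Hom M X {pr}"
    proof
      show "(X, \<lambda>x\<in>X. pr, {pr}) \<in> Hom M X {pr}"
        by (simp add: const_computable pairing_mem)
    next
      fix f assume "f \<in> Hom M X {pr}"
      then obtain g where g: "f = (X, g, {pr})" "g \<in> computable X {pr}"
        by (rule Hom_ModpE)
      have "g = (\<lambda>x\<in>X. pr)"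
        using computable_PiE[OF g(2)] by (auto simp: fun_eq_iff PiE_iff extensional_def)
      then show "f = (X, \<lambda>x\<in>X. pr, {pr})"
        by (simp add: g(1))
    qed
  qed
qed

lemma Modp_category: "category_with_products M"
proof
  fix f X Y g Z h W
  assume f: "f \<in> Hom M X Y" and g: "g \<in> Hom M Y Z" and h: "h \<in> Hom M Z W"
  then show "Comp M h (Comp M g f) = Comp M (Comp M h g) f"
    by (auto elim!: Hom_ModpE simp: compose_def fun_eq_iff computable_mem)
next
  fix f X Y assume "f \<in> Hom M X Y"
  then obtain f' where f': "f = (X, f', Y)" "f' \<in> computable X Y"
    by (rule Hom_ModpE)
  note PiE = computable_PiE[OF f'(2)]
  show "Comp M f (Ident M X) = f"
    using PiE by (auto simp: f'(1) compose_def fun_eq_iff PiE_def extensional_def)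
  show "Comp M (Ident M Y) f = f"
    using PiE by (auto simp: f'(1) compose_def fun_eq_iff PiE_iff extensional_def)
next
  fix f g Z X Y assume "f \<in> Hom M Z X" "g \<in> Hom M Z Y"
  then show "\<exists>!h. h \<in> Hom M Z (Prod M X Y) \<and>
      Comp M (Proj1 M X Y) h = f \<and> Comp M (Proj2 M X Y) h = g"
    by (rule Modp_Prod_universal)
next
  show "\<exists>T\<in>Ob M. \<forall>X\<in>Ob M. \<exists>!f. f \<in> Hom M X T"
    by (rule Modp_terminal)
qed (auto elim!: Hom_ModpE simp: id_computable comp_computable pfst_computable psnd_computable)

text \<open>Evaluates the definite description in \<open>prod_ident\<close>: the explicit map
  satisfies both triangle equations, and the universal property makes it the only such
  arrow.\<close>

lemma prod_ident_Modp:
  assumes u: "u \<in> computable X X'"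
  shows "prod_ident M (X, u, X') Y
    = (X \<otimes> Y, \<lambda>p\<in>X \<otimes> Y. tup (u (pfst p)) (psnd p), X' \<otimes> Y)"
    and "(\<lambda>p\<in>X \<otimes> Y. tup (u (pfst p)) (psnd p)) \<in> computable (X \<otimes> Y) (X' \<otimes> Y)"
proof -
  let ?h = "\<lambda>p\<in>X \<otimes> Y. tup (u (pfst p)) (psnd p)"
  have u_pfst: "compose (X \<otimes> Y) u (\<lambda>p\<in>X \<otimes> Y. pfst p) \<in> computable (X \<otimes> Y) X'"
    by (rule comp_computable[OF pfst_computable u])
  have "(\<lambda>p\<in>X \<otimes> Y. tup (compose (X \<otimes> Y) u (\<lambda>p\<in>X \<otimes> Y. pfst p) p) ((\<lambda>p\<in>X \<otimes> Y. psnd p) p)) = ?h"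
    by (auto simp: compose_def fun_eq_iff)
  with tup_computable[OF u_pfst psnd_computable]
  show h: "?h \<in> computable (X \<otimes> Y) (X' \<otimes> Y)" by simp
  let ?P = "\<lambda>h. h \<in> Hom M (X \<otimes> Y) (Prod M X' Y) \<and>
    Comp M (Proj1 M X' Y) h = Comp M (X, u, X') (Proj1 M X Y) \<and>
    Comp M (Proj2 M X' Y) h = Proj2 M X Y"
  have "Comp M (X, u, X') (Proj1 M X Y) \<in> Hom M (X \<otimes> Y) X'" "Proj2 M X Y \<in> Hom M (X \<otimes> Y) Y"
    using u_pfst psnd_computable by simp_all
  then have "\<exists>!h. ?P h"
    by (rule Modp_Prod_universal)
  moreover have "?P (X \<otimes> Y, ?h, X' \<otimes> Y)"
    using h computable_mem[OF u] by (auto simp: compose_def fun_eq_iff elim!: pairE)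
  ultimately show "prod_ident M (X, u, X') Y = (X \<otimes> Y, ?h, X' \<otimes> Y)"
    unfolding prod_ident_def by (intro the1_equality) simp_all
qed

section \<open>The Weihrauch doctrines\<close>

lemma elem_weihrauch_reflected:
  "E = reflected_doctrine M eW_objects (eW_le app A' pr) (\<lambda>(X, u, Y) f. \<lambda>x\<in>X. f (u x))"
  by (auto simp: elem_weihrauch_def reflected_doctrine_def fun_eq_iff)

lemma weihrauch_reflected:
  "weihrauch app A' pr = reflected_doctrine M W_objects (W_le app A' pr)
     (\<lambda>(X, u, X') (Y, F). (Y, \<lambda>x\<in>X. F (u x)))"
  by (auto simp: weihrauch_def reflected_doctrine_def fun_eq_iff)

lemma ex_completion_reflected:
  "ex_completion M E = reflected_doctrine M (ex_objects M E) (ex_le M E) (ex_reindex M E)"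
  by (simp add: ex_completion_def reflected_doctrine_def)

section \<open>The elementary Weihrauch preorder\<close>

lemma eW_le_refl: "eW_le app A' pr X f f"
  \<comment> \<open>The realizer \<open>p2\<close> returns the given answer unchanged.\<close>
  unfolding eW_le_def by (rule bexI[OF _ pairing_mem(3)]) simp

text \<open>Answers travel backwards: \<open>b\<close> turns an answer for \<open>l\<close> into one
  for \<open>g\<close>, and \<open>a\<close> turns that into one for \<open>f\<close>. As
  \<open>a\<close> also needs the instance, the composite sends \<open>tup p q\<close> to the value
  of \<open>a\<close> at the pair of \<open>p\<close> and \<open>b\<close> applied to
  \<open>tup p q\<close>.\<close>

lemma eW_le_trans:
  assumes "eW_le app A' pr X f g" and "eW_le app A' pr X g l"
  shows "eW_le app A' pr X f l"
proof -
  obtain a where a: "a \<in> A'" "\<And>p q. p \<in> X \<Longrightarrow> q \<in> g p \<Longrightarrow> \<exists>r\<in>f p. app a (tup p q) = Some r"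
    using assms(1) by (auto simp: eW_le_def)
  obtain b where b: "b \<in> A'" "\<And>p q. p \<in> X \<Longrightarrow> q \<in> l p \<Longrightarrow> \<exists>r\<in>g p. app b (tup p q) = Some r"
    using assms(2) by (auto simp: eW_le_def)
  obtain d where d: "d \<in> A'"
    "\<And>x y z. app p1 x = Some y \<Longrightarrow> app b x = Some z \<Longrightarrow> app d x = Some (tup y z)"
    by (rule tup_realizer[OF pairing_mem(2) b(1)]) blast
  obtain c where c: "c \<in> A'" "\<And>x y z. app d x = Some y \<Longrightarrow> app a y = Some z \<Longrightarrow> app c x = Some z"
    by (rule comp_realizer[OF a(1) d(1)]) blast
  have "\<exists>r\<in>f p. app c (tup p q) = Some r" if p: "p \<in> X" and q: "q \<in> l p" for p q
    using a(2)[OF p] b(2)[OF p q] c(2) d(2) proj_tup(1) by metis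
  with c(1) show ?thesis
    by (auto simp: eW_le_def)
qed

text \<open>Realizers of reductions take an instance paired with an answer. This element changes the
  instance along \<open>u\<close> and keeps the answer, which may be any element of the
  algebra.\<close>

lemma first_map_realizer:
  assumes "u \<in> computable X X'"
  obtains c where "c \<in> A'" "\<And>x y. x \<in> X \<Longrightarrow> app c (tup x y) = Some (tup (u x) y)"
proof -
  obtain a where a: "a \<in> A'" "\<And>x. x \<in> X \<Longrightarrow> app a x = Some (u x)"
    by (rule computableE[OF assms]) blast
  obtain b where b: "b \<in> A'" "\<And>x y z. app p1 x = Some y \<Longrightarrow> app a y = Some z \<Longrightarrow> app b x = Some z"
    by (rule comp_realizer[OF a(1) pairing_mem(2)]) blast
  obtain c where "c \<in> A'"
    "\<And>x y z. app b x = Some y \<Longrightarrow> app p2 x = Some z \<Longrightarrow> app c x = Some (tup y z)"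
    by (rule tup_realizer[OF b(1) pairing_mem(3)]) blast
  with a b that show thesis
    by (metis proj_tup)
qed

lemma eW_le_reindex:
  assumes u: "u \<in> computable X X'" and "eW_le app A' pr X' f g"
  shows "eW_le app A' pr X (\<lambda>x\<in>X. f (u x)) (\<lambda>x\<in>X. g (u x))"
proof -
  obtain a where a: "a \<in> A'" "\<And>p q. p \<in> X' \<Longrightarrow> q \<in> g p \<Longrightarrow> \<exists>r\<in>f p. app a (tup p q) = Some r"
    using assms(2) by (auto simp: eW_le_def)
  obtain b where b: "b \<in> A'" "\<And>x y. x \<in> X \<Longrightarrow> app b (tup x y) = Some (tup (u x) y)"
    by (rule first_map_realizer[OF u]) blast
  obtain c where c: "c \<in> A'" "\<And>x y z. app b x = Some y \<Longrightarrow> app a y = Some z \<Longrightarrow> app c x = Some z"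
    by (rule comp_realizer[OF a(1) b(1)]) blast
  have "\<exists>r\<in>f (u p). app c (tup p q) = Some r" if "p \<in> X" and "q \<in> g (u p)" for p q
    using a(2)[OF computable_mem[OF u that(1)] that(2)] b(2)[OF that(1)] c(2) by metis
  with c(1) show ?thesis
    by (auto simp: eW_le_def)
qed

lemma elem_weihrauch_preorder_doctrine:
  "preorder_doctrine M eW_objects (eW_le app A' pr) (\<lambda>(X, u, Y) f. \<lambda>x\<in>X. f (u x))"
proof -
  interpret category_with_products M by (rule Modp_category)
  show ?thesis
  proof
    show "reflp_on (eW_objects X) (eW_le app A' pr X)" for X
      by (simp add: reflp_on_def eW_le_refl)
    show "transp_on (eW_objects X) (eW_le app A' pr X)" for X
      using eW_le_trans by (auto simp: transp_on_def)
  qed (auto elim!: Hom_ModpE simp: eW_objects_def eW_le_reindex compose_def fun_eq_iff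
      computable_mem PiE_iff extensional_def)
qed

section \<open>The preorder of generalized Weihrauch predicates\<close>

lemma W_le_refl: "W_le app A' pr X (Y, F) (Y, F)"
  \<comment> \<open>The parameter map is the second projection, giving back \<open>y\<close>, and
    the realizer \<open>p2\<close> gives back the answer \<open>q\<close>.\<close>
  unfolding W_le_def prod.case
  by (rule bexI[OF _ psnd_computable], rule bexI[OF _ pairing_mem(3)]) simp

lemma W_leI:
  assumes "k \<in> computable (X \<otimes> Y) Z" and "h \<in> A'"
    and "\<And>x y q. x \<in> X \<Longrightarrow> y \<in> Y \<Longrightarrow> q \<in> G x (k (tup x y)) \<Longrightarrow>
      \<exists>r\<in>F x y. app h (tup (tup x y) q) = Some r"
  shows "W_le app A' pr X (Y, F) (Z, G)"
  unfolding W_le_def prod.case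
  by (intro bexI[OF _ assms(1)] bexI[OF _ assms(2)] ballI assms(3))

lemma W_leE:
  assumes "W_le app A' pr X (Y, F) (Z, G)"
  obtains k h where "k \<in> computable (X \<otimes> Y) Z" "h \<in> A'"
    "\<And>x y q. x \<in> X \<Longrightarrow> y \<in> Y \<Longrightarrow> q \<in> G x (k (tup x y)) \<Longrightarrow>
      \<exists>r\<in>F x y. app h (tup (tup x y) q) = Some r"
  using assms unfolding W_le_def prod.case by metis

text \<open>The composite parameter map sends \<open>tup x y\<close> to
  \<open>l (tup x (k (tup x y)))\<close>. An answer \<open>q\<close> for \<open>H\<close> is first
  sent by \<open>b\<close> to an answer for \<open>G\<close> at the parameter
  \<open>k (tup x y)\<close>, then by \<open>a\<close> to an answer for \<open>F\<close>.\<close>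

lemma W_le_trans:
  assumes "W_le app A' pr X (Y, F) (Z, G)" and "W_le app A' pr X (Z, G) (V, H)"
  shows "W_le app A' pr X (Y, F) (V, H)"
proof -
  obtain k a where k: "k \<in> computable (X \<otimes> Y) Z" and a: "a \<in> A'"
    "\<And>x y q. x \<in> X \<Longrightarrow> y \<in> Y \<Longrightarrow> q \<in> G x (k (tup x y)) \<Longrightarrow>
      \<exists>r\<in>F x y. app a (tup (tup x y) q) = Some r"
    by (rule W_leE[OF assms(1)]) blast
  obtain l b where l: "l \<in> computable (X \<otimes> Z) V" and b: "b \<in> A'"
    "\<And>x z q. x \<in> X \<Longrightarrow> z \<in> Z \<Longrightarrow> q \<in> H x (l (tup x z)) \<Longrightarrow>
      \<exists>r\<in>G x z. app b (tup (tup x z) q) = Some r"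
    by (rule W_leE[OF assms(2)]) blast
  \<comment> \<open>The instance of the second reduction: the same \<open>x\<close>, with the
    parameter chosen by the first.\<close>
  let ?v = "\<lambda>p\<in>X \<otimes> Y. tup ((\<lambda>p\<in>X \<otimes> Y. pfst p) p) (k p)"
  have v: "?v \<in> computable (X \<otimes> Y) (X \<otimes> Z)"
    by (rule tup_computable[OF pfst_computable k])
  obtain e where e: "e \<in> A'" "\<And>p q. p \<in> X \<otimes> Y \<Longrightarrow> app e (tup p q) = Some (tup (?v p) q)"
    by (rule first_map_realizer[OF v]) blast
  obtain b' where b': "b' \<in> A'" "\<And>x y z. app e x = Some y \<Longrightarrow> app b y = Some z \<Longrightarrow> app b' x = Some z"
    by (rule comp_realizer[OF b(1) e(1)]) blast
  \<comment> \<open>This restores the original instance \<open>tup x y\<close> next to the answer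
    produced by \<open>b\<close>, since that is the input \<open>a\<close> expects.\<close>
  obtain d where d: "d \<in> A'"
    "\<And>x y z. app p1 x = Some y \<Longrightarrow> app b' x = Some z \<Longrightarrow> app d x = Some (tup y z)"
    by (rule tup_realizer[OF pairing_mem(2) b'(1)]) blast
  obtain c where c: "c \<in> A'" "\<And>x y z. app d x = Some y \<Longrightarrow> app a y = Some z \<Longrightarrow> app c x = Some z"
    by (rule comp_realizer[OF a(1) d(1)]) blast
  show ?thesis
  proof (rule W_leI[OF comp_computable[OF v l] c(1)])
    fix x y q
    assume xy: "x \<in> X" "y \<in> Y" and "q \<in> H x (compose (X \<otimes> Y) l ?v (tup x y))"
    then have q: "q \<in> H x (l (tup x (k (tup x y))))"
      by (simp add: compose_def)
    have "k (tup x y) \<in> Z"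
      using k xy by (auto intro: computable_mem)
    then obtain r where r: "r \<in> G x (k (tup x y))" "app b (tup (tup x (k (tup x y))) q) = Some r"
      using b(2)[OF xy(1) _ q] by auto
    have "app e (tup (tup x y) q) = Some (tup (tup x (k (tup x y))) q)"
      using e(2)[of "tup x y" q] xy by simp
    then have "app d (tup (tup x y) q) = Some (tup (tup x y) r)"
      using r(2) b'(2) d(2) proj_tup(1) by blast
    then show "\<exists>r\<in>F x y. app c (tup (tup x y) q) = Some r"
      using a(2)[OF xy r(1)] c(2) by blast
  qed
qed

text \<open>Both the parameter map and the answer realizer are precomposed with the change of
  instance from \<open>tup x y\<close> to \<open>tup (u x) y\<close>.\<close>

lemma W_le_reindex:
  assumes u: "u \<in> computable X X'" and "W_le app A' pr X' (Y, F) (Z, G)"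
  shows "W_le app A' pr X (Y, \<lambda>x\<in>X. F (u x)) (Z, \<lambda>x\<in>X. G (u x))"
proof -
  obtain k a where k: "k \<in> computable (X' \<otimes> Y) Z" and a: "a \<in> A'"
    "\<And>x y q. x \<in> X' \<Longrightarrow> y \<in> Y \<Longrightarrow> q \<in> G x (k (tup x y)) \<Longrightarrow>
      \<exists>r\<in>F x y. app a (tup (tup x y) q) = Some r"
    by (rule W_leE[OF assms(2)]) blast
  let ?v = "\<lambda>p\<in>X \<otimes> Y. tup (u (pfst p)) (psnd p)"
  have v: "?v \<in> computable (X \<otimes> Y) (X' \<otimes> Y)"
    by (rule prod_ident_Modp(2)[OF u])
  obtain e where e: "e \<in> A'" "\<And>p q. p \<in> X \<otimes> Y \<Longrightarrow> app e (tup p q) = Some (tup (?v p) q)"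
    by (rule first_map_realizer[OF v]) blast
  obtain c where c: "c \<in> A'" "\<And>x y z. app e x = Some y \<Longrightarrow> app a y = Some z \<Longrightarrow> app c x = Some z"
    by (rule comp_realizer[OF a(1) e(1)]) blast
  show ?thesis
  proof (rule W_leI[OF comp_computable[OF v k] c(1)])
    fix x y q
    assume xy: "x \<in> X" "y \<in> Y" and "q \<in> (\<lambda>x\<in>X. G (u x)) x (compose (X \<otimes> Y) k ?v (tup x y))"
    then have q: "q \<in> G (u x) (k (tup (u x) y))"
      by (simp add: compose_def)
    have "app e (tup (tup x y) q) = Some (tup (tup (u x) y) q)"
      using e(2)[of "tup x y" q] xy by simp
    then show "\<exists>r\<in>(\<lambda>x\<in>X. F (u x)) x y. app c (tup (tup x y) q) = Some r"
      using a(2)[OF computable_mem[OF u xy(1)] xy(2) q] c(2) xy(1) by auto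
  qed
qed

lemma weihrauch_preorder_doctrine:
  "preorder_doctrine M W_objects (W_le app A' pr) (\<lambda>(X, u, X') (Y, F). (Y, \<lambda>x\<in>X. F (u x)))"
proof -
  interpret category_with_products M by (rule Modp_category)
  show ?thesis
  proof
    show "reflp_on (W_objects X) (W_le app A' pr X)" for X
      by (auto simp: reflp_on_def W_le_refl)
    show "transp_on (W_objects X) (W_le app A' pr X)" for X
      unfolding transp_on_def using W_le_trans by auto
  next
    fix u :: "'a marrow" and X X' and x :: "'a wpred"
    assume u: "u \<in> Hom M X X'" and x: "x \<in> W_objects X'"
    obtain f where f: "u = (X, f, X')" "f \<in> computable X X'"
      using u by (rule Hom_ModpE)
    obtain Y F where F: "x = (Y, F)" "F \<in> X' \<rightarrow>\<^sub>E (Y \<rightarrow>\<^sub>E nonempty_subsets)"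
      using x by (auto simp only: W_objects_def)
    have "F (f p) \<in> Y \<rightarrow>\<^sub>E nonempty_subsets" if "p \<in> X" for p
      by (rule PiE_mem[OF F(2) computable_mem[OF f(2) that]])
    then show "(case u of (X, u, X') \<Rightarrow> \<lambda>(Y, F). (Y, \<lambda>x\<in>X. F (u x))) x \<in> W_objects X"
      by (simp add: W_objects_def f(1) F(1) restrict_PiE_iff)
  next
    fix u :: "'a marrow" and X X' and x y :: "'a wpred"
    assume "u \<in> Hom M X X'" and "W_le app A' pr X' x y"
    then show "W_le app A' pr X ((case u of (X, u, X') \<Rightarrow> \<lambda>(Y, F). (Y, \<lambda>x\<in>X. F (u x))) x)
        ((case u of (X, u, X') \<Rightarrow> \<lambda>(Y, F). (Y, \<lambda>x\<in>X. F (u x))) y)"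
      by (cases x, cases y) (auto elim!: Hom_ModpE simp: W_le_reindex)
  qed (auto elim!: Hom_ModpE simp: W_objects_def compose_def fun_eq_iff computable_mem PiE_iff
      extensional_def)
qed

section \<open>Uncurrying\<close>

text \<open>Projections are used because elements of the product are coded pairs inside the algebra
  rather than pairs of the logic.\<close>

definition uncurry_pred :: "'a set \<Rightarrow> 'a set \<Rightarrow> ('a \<Rightarrow> 'a \<Rightarrow> 'a set) \<Rightarrow> 'a \<Rightarrow> 'a set" where
  "uncurry_pred X Y F = (\<lambda>p\<in>X \<otimes> Y. F (pfst p) (psnd p))"

text \<open>The value is a generating pair of the completion, whose second component is already a
  class of the elementary doctrine. The outer classes are formed later by
  \<open>reflect_map\<close>.\<close>

definition to_completion :: "'a set \<Rightarrow> 'a wpred \<Rightarrow> 'a set \<times> ('a \<Rightarrow> 'a set) set" where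
  "to_completion X = (\<lambda>(Y, F). (Y, eW_class app A' pr (X \<otimes> Y) (uncurry_pred X Y F)))"

lemma uncurry_pred_tup: "x \<in> X \<Longrightarrow> y \<in> Y \<Longrightarrow> uncurry_pred X Y F (tup x y) = F x y"
  by (simp add: uncurry_pred_def)

lemma uncurry_pred_mem: "(Y, F) \<in> W_objects X \<Longrightarrow> uncurry_pred X Y F \<in> eW_objects (X \<otimes> Y)"
  by (auto simp: W_objects_def eW_objects_def uncurry_pred_def PiE_iff elim!: pairE)

lemma curry_pred_mem: "f \<in> eW_objects (X \<otimes> Y) \<Longrightarrow> (Y, curry_pred app pr X Y f) \<in> W_objects X"
  by (auto simp: W_objects_def eW_objects_def curry_pred_def PiE_iff)

lemma uncurry_curry_pred:
  "f \<in> eW_objects (X \<otimes> Y) \<Longrightarrow> uncurry_pred X Y (curry_pred app pr X Y f) = f"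
  by (auto simp: eW_objects_def uncurry_pred_def curry_pred_def fun_eq_iff PiE_iff extensional_def
      elim!: pairE)

lemma to_completion_curry:
  "f \<in> eW_objects (X \<otimes> Y) \<Longrightarrow>
    to_completion X (Y, curry_pred app pr X Y f) = (Y, eW_class app A' pr (X \<otimes> Y) f)"
  by (simp add: to_completion_def uncurry_curry_pred)

interpretation eW: preorder_doctrine M eW_objects "eW_le app A' pr" "\<lambda>(X, u, Y) f. \<lambda>x\<in>X. f (u x)"
  by (rule elem_weihrauch_preorder_doctrine)

section \<open>Generating pairs of the completion and their preorder\<close>

lemma ex_objects_eq:
  "ex_objects M E X = {(Y, eW_class app A' pr (X \<otimes> Y) f) | Y f. f \<in> eW_objects (X \<otimes> Y)}"
  by (auto simp: ex_objects_def elem_weihrauch_reflected eW.Fib_carrier eW_class_def)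

text \<open>A class in the fibre over the product has a representative \<open>f\<close>, and
  uncurrying the curried \<open>f\<close> gives back \<open>f\<close> itself.\<close>

lemma to_completion_onto: "to_completion X ` W_objects X = ex_objects M E X"
proof
  show "to_completion X ` W_objects X \<subseteq> ex_objects M E X"
    by (auto simp: to_completion_def ex_objects_eq) (blast intro: uncurry_pred_mem)
  show "ex_objects M E X \<subseteq> to_completion X ` W_objects X"
  proof
    fix c assume "c \<in> ex_objects M E X"
    then obtain Y f where f: "f \<in> eW_objects (X \<otimes> Y)" "c = (Y, eW_class app A' pr (X \<otimes> Y) f)"
      unfolding ex_objects_eq by blast
    show "c \<in> to_completion X ` W_objects X"
      by (rule image_eqI[OF _ curry_pred_mem[OF f(1)]]) (simp add: to_completion_curry f)
  qed
qed

lemma E_reindex_class: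
  assumes "u \<in> computable X Y" and "f \<in> eW_objects Y"
  shows "Reindex E (X, u, Y) (eW_class app A' pr Y f) = eW_class app A' pr X (\<lambda>x\<in>X. f (u x))"
  using eW.Reindex_class[of "(X, u, Y)" X Y f] assms
  by (simp add: elem_weihrauch_reflected eW_class_def)

text \<open>Removes all classes from the order of the completion. Being an arrow over
  \<open>X\<close> means keeping first components, and reindexing of a class along \<open>h\<close>
  is computed on its representative.\<close>

lemma ex_le_class_iff:
  assumes "f \<in> eW_objects (X \<otimes> Y)" and "g \<in> eW_objects (X \<otimes> Z)"
  shows "ex_le M E X (Y, eW_class app A' pr (X \<otimes> Y) f) (Z, eW_class app A' pr (X \<otimes> Z) g) \<longleftrightarrow>
    (\<exists>h\<in>computable (X \<otimes> Y) (X \<otimes> Z). (\<forall>x\<in>X. \<forall>y\<in>Y. pfst (h (tup x y)) = x) \<and>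
       eW_le app A' pr (X \<otimes> Y) f (\<lambda>p\<in>X \<otimes> Y. g (h p)))"
proof -
  have "eW_class app A' pr (X \<otimes> Y) f \<sqsubseteq>\<^bsub>Fib E (X \<otimes> Y)\<^esub>
      Reindex E (X \<otimes> Y, h, X \<otimes> Z) (eW_class app A' pr (X \<otimes> Z) g)
    \<longleftrightarrow> eW_le app A' pr (X \<otimes> Y) f (\<lambda>p\<in>X \<otimes> Y. g (h p))"
    if h: "h \<in> computable (X \<otimes> Y) (X \<otimes> Z)" for h
  proof -
    have "(\<lambda>p\<in>X \<otimes> Y. g (h p)) \<in> eW_objects (X \<otimes> Y)"
      using assms(2) computable_mem[OF h] by (auto simp: eW_objects_def)
    then show ?thesis
      using eW.Fib_le[of "X \<otimes> Y" f] assms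
      by (simp add: E_reindex_class[OF h]) (simp add: elem_weihrauch_reflected eW_class_def)
  qed
  moreover have "compose (X \<otimes> Y) (\<lambda>p\<in>X \<otimes> Z. pfst p) h = (\<lambda>p\<in>X \<otimes> Y. pfst p)
    \<longleftrightarrow> (\<forall>x\<in>X. \<forall>y\<in>Y. pfst (h (tup x y)) = x)"
    if h: "h \<in> computable (X \<otimes> Y) (X \<otimes> Z)" for h
    using computable_mem[OF h] by (force simp: compose_def fun_eq_iff elim!: pairE)
  moreover have "(\<exists>u\<in>Hom M (X \<otimes> Y) (X \<otimes> Z). \<phi> u)
    \<longleftrightarrow> (\<exists>h\<in>computable (X \<otimes> Y) (X \<otimes> Z). \<phi> (X \<otimes> Y, h, X \<otimes> Z))" for \<phi>
    by (auto simp: Hom_Modp)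
  ultimately show ?thesis
    unfolding ex_le_def prod.case Modp_simps by (simp cong: bex_cong_simp)
qed

text \<open>The answer realizer \<open>a\<close> is the same in both directions. Only the forward
  map changes: \<open>h\<close> is followed by the second projection, and \<open>k\<close> is paired
  with the first projection.\<close>

lemma to_completion_le:
  assumes F: "(Y, F) \<in> W_objects X" and G: "(Z, G) \<in> W_objects X"
  shows "ex_le M E X (to_completion X (Y, F)) (to_completion X (Z, G))
    \<longleftrightarrow> W_le app A' pr X (Y, F) (Z, G)"
proof -
  let ?F = "uncurry_pred X Y F" and ?G = "uncurry_pred X Z G"
  have iff: "ex_le M E X (to_completion X (Y, F)) (to_completion X (Z, G)) \<longleftrightarrow>
    (\<exists>h\<in>computable (X \<otimes> Y) (X \<otimes> Z). (\<forall>x\<in>X. \<forall>y\<in>Y. pfst (h (tup x y)) = x) \<and>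
       eW_le app A' pr (X \<otimes> Y) ?F (\<lambda>p\<in>X \<otimes> Y. ?G (h p)))"
    using ex_le_class_iff[OF uncurry_pred_mem[OF F] uncurry_pred_mem[OF G]]
    by (simp add: to_completion_def)
  show ?thesis
    unfolding iff
  proof
    assume "\<exists>h\<in>computable (X \<otimes> Y) (X \<otimes> Z). (\<forall>x\<in>X. \<forall>y\<in>Y. pfst (h (tup x y)) = x) \<and>
       eW_le app A' pr (X \<otimes> Y) ?F (\<lambda>p\<in>X \<otimes> Y. ?G (h p))"
    then obtain h a where h: "h \<in> computable (X \<otimes> Y) (X \<otimes> Z)"
        "\<And>x y. x \<in> X \<Longrightarrow> y \<in> Y \<Longrightarrow> pfst (h (tup x y)) = x"
      and a: "a \<in> A'" "\<And>p q. p \<in> X \<otimes> Y \<Longrightarrow> q \<in> ?G (h p) \<Longrightarrow> \<exists>r\<in>?F p. app a (tup p q) = Some r"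
      by (auto simp: eW_le_def)
    let ?k = "compose (X \<otimes> Y) (\<lambda>p\<in>X \<otimes> Z. psnd p) h"
    show "W_le app A' pr X (Y, F) (Z, G)"
    proof (rule W_leI[OF comp_computable[OF h(1) psnd_computable] a(1)])
      fix x y q assume xy: "x \<in> X" "y \<in> Y" and q: "q \<in> G x (?k (tup x y))"
      have p: "tup x y \<in> X \<otimes> Y" using xy by simp
      \<comment> \<open>As \<open>h\<close> lies over \<open>X\<close>, the first component
        \<open>x'\<close> must be \<open>x\<close>, and the second is the value of the new parameter
        map.\<close>
      obtain x' z where "x' \<in> X" "z \<in> Z" "h (tup x y) = tup x' z"
        using computable_mem[OF h(1) p] by (auto elim: pairE)
      with h(2)[OF xy] have z: "z \<in> Z" "h (tup x y) = tup x z" by simp_all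
      then have "?G (h (tup x y)) = G x (?k (tup x y))"
        using xy by (simp add: compose_def uncurry_pred_tup)
      then show "\<exists>r\<in>F x y. app a (tup (tup x y) q) = Some r"
        using a(2)[OF p] q xy by (simp add: uncurry_pred_tup)
    qed
  next
    assume "W_le app A' pr X (Y, F) (Z, G)"
    then obtain k a where k: "k \<in> computable (X \<otimes> Y) Z" and a: "a \<in> A'"
      "\<And>x y q. x \<in> X \<Longrightarrow> y \<in> Y \<Longrightarrow> q \<in> G x (k (tup x y)) \<Longrightarrow>
        \<exists>r\<in>F x y. app a (tup (tup x y) q) = Some r"
      by (rule W_leE) blast
    let ?h = "\<lambda>p\<in>X \<otimes> Y. tup ((\<lambda>p\<in>X \<otimes> Y. pfst p) p) (k p)"
    have h: "?h \<in> computable (X \<otimes> Y) (X \<otimes> Z)"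
      by (rule tup_computable[OF pfst_computable k])
    moreover have "\<forall>x\<in>X. \<forall>y\<in>Y. pfst (?h (tup x y)) = x"
      by simp
    moreover have "eW_le app A' pr (X \<otimes> Y) ?F (\<lambda>p\<in>X \<otimes> Y. ?G (?h p))"
      unfolding eW_le_def
    proof (intro bexI[OF _ a(1)] ballI)
      fix p q assume p: "p \<in> X \<otimes> Y" and q: "q \<in> (\<lambda>p\<in>X \<otimes> Y. ?G (?h p)) p"
      obtain x y where xy: "x \<in> X" "y \<in> Y" "p = tup x y"
        using p by (rule pairE)
      \<comment> \<open>Uncurried \<open>G\<close> has its intended value only on pairs from the
        product of \<open>X\<close> and \<open>Z\<close>.\<close>
      have "k (tup x y) \<in> Z"
        using computable_mem[OF k] xy by simp
      then have "q \<in> G x (k (tup x y))"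
        using q xy by (simp add: uncurry_pred_tup)
      then show "\<exists>r\<in>?F p. app a (tup p q) = Some r"
        using a(2) xy by (simp add: uncurry_pred_tup)
    qed
    ultimately show "\<exists>h\<in>computable (X \<otimes> Y) (X \<otimes> Z). (\<forall>x\<in>X. \<forall>y\<in>Y. pfst (h (tup x y)) = x) \<and>
       eW_le app A' pr (X \<otimes> Y) ?F (\<lambda>p\<in>X \<otimes> Y. ?G (h p))"
      by blast
  qed
qed

text \<open>Both sides have the parameter set \<open>Y\<close> and the class of the function sending
  \<open>tup x y\<close> to \<open>F (u x) y\<close>. They are therefore equal as generating pairs,
  before any outer class is taken.\<close>

lemma to_completion_natural:
  assumes u: "u \<in> computable X X'" and F: "(Y, F) \<in> W_objects X'"
  shows "ex_reindex M E (X, u, X') (to_completion X' (Y, F))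
    = to_completion X (Y, \<lambda>x\<in>X. F (u x))"
proof -
  let ?v = "\<lambda>p\<in>X \<otimes> Y. tup (u (pfst p)) (psnd p)"
  have "(\<lambda>p\<in>X \<otimes> Y. uncurry_pred X' Y F (?v p)) = uncurry_pred X Y (\<lambda>x\<in>X. F (u x))"
    using computable_mem[OF u] by (auto simp: uncurry_pred_def fun_eq_iff elim!: pairE)
  then show ?thesis
    using E_reindex_class[OF prod_ident_Modp(2)[OF u] uncurry_pred_mem[OF F]]
    by (simp add: ex_reindex_def to_completion_def prod_ident_Modp(1)[OF u])
qed

text \<open>The first claim supplies reflexivity and transitivity of the preorder of the completion,
  by which the isomorphism is computed on classes afterwards.\<close>

lemma to_completion_isomorphism:
  "preorder_doctrine M (ex_objects M E) (ex_le M E) (ex_reindex M E)" (is ?transported)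
  "doctrine_isomorphism M (weihrauch app A' pr) (ex_completion M E)
     (\<lambda>X. reflect_map (ex_objects M E X) (ex_le M E X) (to_completion X))" (is ?iso)
proof -
  interpret W: preorder_doctrine M W_objects "W_le app A' pr"
    "\<lambda>(X, u, X') (Y, F). (Y, \<lambda>x\<in>X. F (u x))"
    by (rule weihrauch_preorder_doctrine)
  have le: "ex_le M E X (to_completion X x) (to_completion X y) \<longleftrightarrow> W_le app A' pr X x y"
    if "x \<in> W_objects X" "y \<in> W_objects X" for X x y
    using that by (cases x, cases y) (simp add: to_completion_le)
  have natural: "ex_reindex M E u (to_completion X' x)
      = to_completion X ((case u of (X, u, X') \<Rightarrow> \<lambda>(Y, F). (Y, \<lambda>x\<in>X. F (u x))) x)"
    if "u \<in> Hom M X X'" "x \<in> W_objects X'" for X X' u x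
    using that by (cases x) (auto elim!: Hom_ModpE simp: to_completion_natural)
  note transport = W.transport[where \<chi> = to_completion and T = "ex_objects M E"
      and R' = "ex_le M E" and r' = "ex_reindex M E", OF to_completion_onto le natural]
  show ?transported
    by (rule transport(1))
  show ?iso
    unfolding weihrauch_reflected ex_completion_reflected by (rule transport(2))
qed

text \<open>Evaluates the isomorphism on a representative; this is what identifies its inverse with
  currying.\<close>

lemma to_completion_class:
  assumes "x \<in> W_objects X"
  shows "reflect_map (ex_objects M E X) (ex_le M E X) (to_completion X) (W_class app A' pr X x)
    = ex_class M E X (to_completion X x)"
proof -
  interpret W: preorder_doctrine M W_objects "W_le app A' pr"
    "\<lambda>(X, u, X') (Y, F). (Y, \<lambda>x\<in>X. F (u x))"
    by (rule weihrauch_preorder_doctrine)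
  interpret ex: preorder_doctrine M "ex_objects M E" "ex_le M E" "ex_reindex M E"
    by (rule to_completion_isomorphism(1))
  show ?thesis
    unfolding W_class_def ex_class_def
  proof (rule reflect_map_class[OF W.refl ex.refl ex.trans])
    show "to_completion X x \<in> ex_objects M E X" if "x \<in> W_objects X" for x
      using that to_completion_onto by blast
    show "ex_le M E X (to_completion X x) (to_completion X y)"
      if "x \<in> W_objects X" "y \<in> W_objects X" "W_le app A' pr X x y" for x y
      using that by (cases x, cases y) (simp add: to_completion_le)
  qed (simp_all add: assms)
qed

end

theorem theorem5p12:
  fixes app :: "'a \<Rightarrow> 'a \<Rightarrow> 'a option" and A' :: "'a set" and pr p1 p2 :: 'a
  assumes "pca app"
    and "elementary_sub_pca app A'"
    and "pairing_elements app A' pr p1 p2"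
  defines "M \<equiv> Modp app A' pr p1 p2"
    and "E \<equiv> elem_weihrauch app A' pr"
  shows "isomorphic_doctrines M (weihrauch app A' pr) (ex_completion M E) \<and>
    (\<exists>\<Phi>. doctrine_isomorphism M (ex_completion M E) (weihrauch app A' pr) \<Phi> \<and>
       (\<forall>X Y. \<forall>f\<in>eW_objects (pca_prod app pr X Y).
          \<Phi> X (ex_class M E X (Y, eW_class app A' pr (pca_prod app pr X Y) f)) =
          W_class app A' pr X (Y, curry_pred app pr X Y f)))"
proof -
  interpret sub_pca_with_pairing app A' pr p1 p2
    using assms(2,3) by unfold_locales
  let ?W = "weihrauch app A' pr"
  let ?\<phi> = "\<lambda>X. reflect_map (ex_objects M E X) (ex_le M E X) (to_completion X)"
  \<comment> \<open>The comparison map is taken as the inverse of the uncurrying isomorphism on the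
    fibres of the Weihrauch doctrine.\<close>
  let ?\<Phi> = "\<lambda>X. inv_into (carrier (Fib ?W X)) (?\<phi> X)"
  have iso: "doctrine_isomorphism M ?W (ex_completion M E) ?\<phi>"
    unfolding M_def E_def by (rule to_completion_isomorphism(2))
  have "?\<Phi> X (ex_class M E X (Y, eW_class app A' pr (pca_prod app pr X Y) f)) =
      W_class app A' pr X (Y, curry_pred app pr X Y f)"
    if f: "f \<in> eW_objects (pca_prod app pr X Y)" for X Y f
  proof -
    let ?c = "W_class app A' pr X (Y, curry_pred app pr X Y f)"
    \<comment> \<open>Uncurrying the curried predicate returns \<open>f\<close>, so the value of the
      isomorphism at \<open>?c\<close> is known. Its injectivity on the fibre then yields the value
      of the inverse.\<close>
    have "?\<phi> X ?c = ex_class M E X (Y, eW_class app A' pr (pca_prod app pr X Y) f)"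
      unfolding M_def E_def using to_completion_class[OF curry_pred_mem[OF f]]
      by (simp add: to_completion_curry[OF f])
    moreover have "?c \<in> carrier (Fib ?W X)"
      using curry_pred_mem[OF f] by (auto simp: weihrauch_def reflection_carrier W_class_def)
    moreover have "inj_on (?\<phi> X) (carrier (Fib ?W X))"
      using iso by (auto simp: doctrine_isomorphism_def poset_isomorphism_def bij_betw_def M_def)
    ultimately show ?thesis
      by (metis inv_into_f_f)
  qed
  then show ?thesis
    using iso doctrine_isomorphism_inverse[OF iso] unfolding isomorphic_doctrines_def by blast
qed

end
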